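(* Let $\{X_n\}_{n\in\mathbb Z}\subset L_H^2$ be a zero mean sequence, and let $v_1,\ldots,v_d$ be any (deterministic) orthonormal functions in $H$. Put $X_{in}=\int_0^1X_n(t)v_i(t)\,dt$, $\mathbf X_n=[X_{1n},\ldots,X_{dn}]^T$ and $\mathbf\Gamma_r=\mathrm{Cov}(\mathbf X_0,\mathbf X_r)=[E(X_{i0}X_{jr})]_{1\le i,j\le d}$. (a) If $\{X_n\}$ is $L^2$--$m$-approximable, then the series $\sum_{r=-\infty}^\infty\mathbf\Gamma_r$ converges absolutely. (b) If, in addition, $\{X_n\}$ is $L^4$--$m$-approximable, the bandwidth $q=q(N)$ and the weights $\omega_q(\cdot)$ satisfy the bandwidth-and-weights conditions (W), and $$N^{-1}\sum_{k,\ell=0}^{q(N)}\sum_{r=1}^{N-1}\max_{1\le i,j\le d}\Bigl|\mathrm{Cov}\Bigl(X_{i0}\bigl(X_{jk}-X_{jk}^{(k)}\bigr),\,X_{ir}^{(r)}X_{j,r+\ell}^{(r+\ell)}\Bigr)\Bigr|\to0\qquad(N\to\infty),$$ where $X_{in}^{(m)}=\int_0^1X_n^{(m)}(t)v_i(t)\,dt$, then $\hat{\mathbf\Sigma}\to\mathbf\Sigma:=\sum_{r=-\infty}^\infty\mathbf\Gamma_r$ in probability as $N\to\infty$, where $\hat{\mathbf\Sigma}$ is the kernel long-run variance estimator computed from $\mathbf X_1,\ldots,\mathbf X_N$.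
   Context: $H=L^2([0,1],\mathcal B_{[0,1]},\lambda)$ with norm $\|f\|^2=\int_0^1|f(t)|^2dt$. $L_H^p$ is the space of $H$-valued random elements $X$ with $\nu_p(X)=(E\|X\|^p)^{1/p}<\infty$. Each $X_n$ is assumed jointly measurable in $(t,\omega)$ with $\sup_{t\in[0,1]}E|X_1(t)|^2<\infty$. $L^p$--$m$-approximability: a sequence $\{X_n\}_{n\in\mathbb Z}\subset L_H^p$ is $L^p$--$m$-approximable if $X_n=f(\varepsilon_n,\varepsilon_{n-1},\ldots)$ for all $n$, where $\{\varepsilon_i\}_{i\in\mathbb Z}$ are i.i.d. elements with values in a measurable space $S$ and $f:S^\infty\to H$ is measurable, and moreover $\sum_{m=1}^\infty\nu_p(X_m-X_m^{(m)})<\infty$, where $$X_n^{(m)}=f\bigl(\varepsilon_n,\ldots,\varepsilon_{n-m+1},\varepsilon_{n-m}^{(n)},\varepsilon_{n-m-1}^{(n)},\ldots\bigr)$$ (so $X_n^{(0)}=f(\varepsilon_n^{(n)},\varepsilon_{n-1}^{(n)},\ldots)$) and, for each $n$, $\{\varepsilon_k^{(n)}\}_{k}$ is an independent copy of $\{\varepsilon_k\}_k$ (these copies for different $n$ being independent of each other and of $\{\varepsilon_k\}$). Kernel estimator: $\hat{\mathbf\Sigma}=\sum_{|r|\le q}\omega_q(r)\hat{\mathbf\Gamma}_r$, where $\hat{\mathbf\Gamma}_r=N^{-1}\sum_{n=1}^{N-r}\mathbf X_n\mathbf X_{n+r}^T$ for $r\ge0$ and $\hat{\mathbf\Gamma}_r=N^{-1}\sum_{n=1}^{N-|r|}\mathbf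 X_{n+|r|}\mathbf X_n^T$ for $r<0$. Conditions (W): $q=q(N)\to\infty$, $q^2/N\to0$; the weights satisfy $\omega_q(j)=\omega_q(-j)$, $|\omega_q(j)|\le b$ for a constant $b$ (all $q,j$), and $\omega_q(j)\to1$ for every fixed $j$. *)

theory Defs
  imports "HOL-Probability.Probability"
begin

text \<open>The space \<open>H = L\<^sup>2([0,1], \<B>, \<lambda>)\<close>. Its elements are handled through representatives
  \<open>real \<Rightarrow> real\<close>, whose values outside \<open>[0,1]\<close> are irrelevant; equality in \<open>H\<close> is equality
  almost everywhere on \<open>[0,1]\<close>.\<close>

definition unit_lborel :: "real measure" where
  "unit_lborel = restrict_space lborel {0..1}"

definition H_carrier :: "(real \<Rightarrow> real) set" where
  "H_carrier = {g. g \<in> borel_measurable unit_lborel \<and> integrable unit_lborel (\<lambda>t. (g t)\<^sup>2)}"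

definition H_inner :: "(real \<Rightarrow> real) \<Rightarrow> (real \<Rightarrow> real) \<Rightarrow> real" where
  "H_inner g h = (LINT t|unit_lborel. g t * h t)"

definition H_norm :: "(real \<Rightarrow> real) \<Rightarrow> real" where
  "H_norm g = sqrt (LINT t|unit_lborel. \<bar>g t\<bar>\<^sup>2)"

definition H_open :: "(real \<Rightarrow> real) set \<Rightarrow> bool" where
  "H_open U \<longleftrightarrow> U \<subseteq> H_carrier \<and>
     (\<forall>g\<in>U. \<exists>e>0. \<forall>h\<in>H_carrier. H_norm (\<lambda>t. h t - g t) < e \<longrightarrow> h \<in> U)"

text \<open>Norm-open sets are closed under equality almost everywhere, so this is the Borel
  \<open>\<sigma>\<close>-algebra of \<open>H\<close> pulled back to representatives.\<close>

definition H_borel :: "(real \<Rightarrow> real) measure" where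
  "H_borel = sigma H_carrier {U. H_open U}"

definition orthonormal_H :: "('d \<Rightarrow> real \<Rightarrow> real) \<Rightarrow> bool" where
  "orthonormal_H v \<longleftrightarrow> (\<forall>i. v i \<in> H_carrier) \<and>
     (\<forall>i j. H_inner (v i) (v j) = (if i = j then 1 else 0))"

text \<open>The moment \<open>E \<parallel>Y\<parallel>\<^sup>p\<close> is a nonnegative integral. In \<open>nu\<close> the conversion \<^const>\<open>enn2real\<close> maps
  an infinite moment to 0, so \<open>nu\<close> is meaningful only when the moment is finite; this is the case for
  elements of \<open>LpH\<close> and differences of such elements.\<close>

definition LpH :: "'w measure \<Rightarrow> real \<Rightarrow> ('w \<Rightarrow> real \<Rightarrow> real) set" where
  "LpH M p = {Y. Y \<in> measurable M H_borel \<and> (\<integral>\<^sup>+ \<omega>. ennreal (H_norm (Y \<omega>) powr p) \<partial>M) < \<infinity>}"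

definition nu :: "'w measure \<Rightarrow> real \<Rightarrow> ('w \<Rightarrow> real \<Rightarrow> real) \<Rightarrow> real" where
  "nu M p Y = enn2real (\<integral>\<^sup>+ \<omega>. ennreal (H_norm (Y \<omega>) powr p) \<partial>M) powr (1 / p)"

definition iid_seq :: "'w measure \<Rightarrow> 's measure \<Rightarrow> (int \<Rightarrow> 'w \<Rightarrow> 's) \<Rightarrow> bool" where
  "iid_seq M S \<epsilon> \<longleftrightarrow> prob_space.indep_vars M (\<lambda>_. S) \<epsilon> UNIV \<and>
     (\<forall>k. distr M S (\<epsilon> k) = distr M S (\<epsilon> 0))"

text \<open>\<open>\<epsilon>c n k\<close> is the \<open>k\<close>-th element of the \<open>n\<close>-th copy. In the family of sequences declared
  independent, the index \<^const>\<open>None\<close> is the original sequence and \<open>Some n\<close> its \<open>n\<close>-th copy.\<close>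

definition independent_copies ::
  "'w measure \<Rightarrow> 's measure \<Rightarrow> (int \<Rightarrow> 'w \<Rightarrow> 's) \<Rightarrow> (int \<Rightarrow> int \<Rightarrow> 'w \<Rightarrow> 's) \<Rightarrow> bool" where
  "independent_copies M S \<epsilon> \<epsilon>c \<longleftrightarrow>
     (\<forall>n. distr M (PiM UNIV (\<lambda>_. S)) (\<lambda>\<omega> k. \<epsilon>c n k \<omega>) = distr M (PiM UNIV (\<lambda>_. S)) (\<lambda>\<omega> k. \<epsilon> k \<omega>)) \<and>
     prob_space.indep_vars M (\<lambda>_. PiM UNIV (\<lambda>_. S))
       (\<lambda>c \<omega> k. case c of None \<Rightarrow> \<epsilon> k \<omega> | Some n \<Rightarrow> \<epsilon>c n k \<omega>) (UNIV :: int option set)"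

text \<open>\<open>coupled f \<epsilon> \<epsilon>c n m\<close> is \<open>X\<^sub>n\<close> with upper index \<open>(m)\<close>: the \<open>m\<close> most recent innovations are
  kept, the older ones are taken from the \<open>n\<close>-th copy.\<close>

definition coupled ::
  "((nat \<Rightarrow> 's) \<Rightarrow> real \<Rightarrow> real) \<Rightarrow> (int \<Rightarrow> 'w \<Rightarrow> 's) \<Rightarrow> (int \<Rightarrow> int \<Rightarrow> 'w \<Rightarrow> 's) \<Rightarrow>
     int \<Rightarrow> nat \<Rightarrow> 'w \<Rightarrow> real \<Rightarrow> real" where
  "coupled f \<epsilon> \<epsilon>c n m \<omega> =
     f (\<lambda>i. if i < m then \<epsilon> (n - int i) \<omega> else \<epsilon>c n (n - int i) \<omega>)"

text \<open>The coupling data \<open>S, f, \<epsilon>, \<epsilon>c\<close> are arguments rather than existentially quantified, because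
  the coupled variables occur outside this definition as well.\<close>

definition Lp_m_approximable ::
  "'w measure \<Rightarrow> 's measure \<Rightarrow> ((nat \<Rightarrow> 's) \<Rightarrow> real \<Rightarrow> real) \<Rightarrow> (int \<Rightarrow> 'w \<Rightarrow> 's) \<Rightarrow>
     (int \<Rightarrow> int \<Rightarrow> 'w \<Rightarrow> 's) \<Rightarrow> real \<Rightarrow> (int \<Rightarrow> 'w \<Rightarrow> real \<Rightarrow> real) \<Rightarrow> bool" where
  "Lp_m_approximable M S f \<epsilon> \<epsilon>c p X \<longleftrightarrow>
     (\<forall>n. X n \<in> LpH M p) \<and>
     iid_seq M S \<epsilon> \<and> independent_copies M S \<epsilon> \<epsilon>c \<and>
     f \<in> measurable (PiM UNIV (\<lambda>_. S)) H_borel \<and>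
     (\<forall>n. AE \<omega> in M. AE t in unit_lborel. X n \<omega> t = f (\<lambda>i. \<epsilon> (n - int i) \<omega>) t) \<and>
     summable (\<lambda>m. nu M p (\<lambda>\<omega> t. X (int (Suc m)) \<omega> t - coupled f \<epsilon> \<epsilon>c (int (Suc m)) (Suc m) \<omega> t))"

definition scores :: "('d::finite \<Rightarrow> real \<Rightarrow> real) \<Rightarrow> (real \<Rightarrow> real) \<Rightarrow> real ^ 'd" where
  "scores v g = (\<chi> i. H_inner g (v i))"

definition covariance :: "'w measure \<Rightarrow> ('w \<Rightarrow> real) \<Rightarrow> ('w \<Rightarrow> real) \<Rightarrow> real" where
  "covariance M A B =
     (LINT \<omega>|M. (A \<omega> - (LINT \<omega>'|M. A \<omega>')) * (B \<omega> - (LINT \<omega>'|M. B \<omega>')))"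

definition autocov ::
  "'w measure \<Rightarrow> ('d::finite \<Rightarrow> real \<Rightarrow> real) \<Rightarrow> (int \<Rightarrow> 'w \<Rightarrow> real \<Rightarrow> real) \<Rightarrow> int \<Rightarrow> real ^ 'd ^ 'd" where
  "autocov M v X r = (\<chi> i j. LINT \<omega>|M. scores v (X 0 \<omega>) $ i * scores v (X r \<omega>) $ j)"

definition outer :: "real ^ 'd \<Rightarrow> real ^ 'd \<Rightarrow> real ^ 'd ^ 'd" where
  "outer x y = (\<chi> i j. x $ i * y $ j)"

definition sample_autocov :: "nat \<Rightarrow> (int \<Rightarrow> real ^ 'd) \<Rightarrow> int \<Rightarrow> real ^ 'd ^ 'd" where
  "sample_autocov N Y r = (1 / real N) *\<^sub>R
     (if r \<ge> 0 then \<Sum>n=1..int N - r. outer (Y n) (Y (n + r))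
      else \<Sum>n=1..int N - \<bar>r\<bar>. outer (Y (n + \<bar>r\<bar>)) (Y n))"

definition kernel_estimator ::
  "(nat \<Rightarrow> int \<Rightarrow> real) \<Rightarrow> nat \<Rightarrow> nat \<Rightarrow> (int \<Rightarrow> real ^ 'd) \<Rightarrow> real ^ 'd ^ 'd" where
  "kernel_estimator w q N Y = (\<Sum>r\<in>{- int q..int q}. w q r *\<^sub>R sample_autocov N Y r)"

definition bandwidth_weights :: "(nat \<Rightarrow> nat) \<Rightarrow> (nat \<Rightarrow> int \<Rightarrow> real) \<Rightarrow> bool" where
  "bandwidth_weights q w \<longleftrightarrow>
     filterlim q at_top sequentially \<and>
     (\<lambda>N. (real (q N))\<^sup>2 / real N) \<longlonglongrightarrow> 0 \<and>
     (\<forall>k j. w k j = w k (- j)) \<and>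
     (\<exists>b. \<forall>k j. \<bar>w k j\<bar> \<le> b) \<and>
     (\<forall>j. (\<lambda>k. w k j) \<longlonglongrightarrow> 1)"

definition tendsto_in_probability ::
  "'w measure \<Rightarrow> (nat \<Rightarrow> 'w \<Rightarrow> 'a::metric_space) \<Rightarrow> 'a \<Rightarrow> bool" where
  "tendsto_in_probability M Z z \<longleftrightarrow>
     (\<forall>e>0. (\<lambda>N. measure M {\<omega> \<in> space M. dist (Z N \<omega>) z > e}) \<longlonglongrightarrow> 0)"

end

theory Submission
  imports Defs
begin

text \<open>Write \<open>x\<^sub>i\<^sub>n\<close> for the score \<open>\<langle>X\<^sub>n, v\<^sub>i\<rangle>\<close> and \<open>x'\<^sub>i\<^sub>k\<close> for the score of the coupled variable with time and upper index
\<open>k\<close>. The argument rests on one independence. The variable \<open>X\<^sub>0\<close> is a function of the innovations at times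
\<open>\<le> 0\<close>, whereas every coupled variable with time and upper index \<open>k\<close> is a function of the innovations at times \<open>1, \<dots>, k\<close> and of
the independent copies. So \<open>X\<^sub>0\<close> is independent of all these coupled variables jointly
(\<open>past_indep_future_copies\<close>), and since \<open>x\<^sub>i\<^sub>0\<close> has mean zero, it is orthogonal to every integrable function of
them (\<open>past_orthogonal\<close>).

Convergence of the series: for \<open>k \<ge> 1\<close> orthogonality gives
\<open>E (x\<^sub>i\<^sub>0 x\<^sub>j\<^sub>k) = E (x\<^sub>i\<^sub>0 (x\<^sub>j\<^sub>k - x'\<^sub>j\<^sub>k))\<close>, and by the Cauchy-Schwarz inequality this is at most a constant times
the coupling error of \<open>X\<^sub>k\<close> in \<open>L\<^sup>2\<close>, which is summable (\<open>autocovariance_decay\<close>). Negative lags follow by stationarity.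

Consistency: an entry of the estimator is split into mean and fluctuation. The mean converges to the entry of the series by
dominated convergence, because the weights are bounded and tend to 1 at each lag
(\<open>truncated_weighted_sum_tendsto_infsum\<close>). By stationarity, the variance of the fluctuation is at most a constant times
\<open>1/N\<close> times the sum of \<open>\<bar>Cov (x\<^sub>i\<^sub>0 x\<^sub>j\<^sub>k, x\<^sub>i\<^sub>r x\<^sub>j\<^sub>s)\<bar>\<close> with \<open>s = r + l\<close>, over lags \<open>k, l \<le> q\<close> and \<open>0 \<le> r < N\<close>
(\<open>weighted_sum_second_moment\<close>). For \<open>r \<ge> 1\<close>, replace \<open>x\<^sub>i\<^sub>r\<close> and \<open>x\<^sub>j\<^sub>s\<close> by their coupled versions. This costs
coupling errors in \<open>L\<^sup>4\<close>, which are summable in \<open>r\<close>. Then split \<open>x\<^sub>j\<^sub>k = (x\<^sub>j\<^sub>k - x'\<^sub>j\<^sub>k) + x'\<^sub>j\<^sub>k\<close>: the first part gives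
the covariance that the hypothesis controls, and the second part gives
\<open>Cov (x\<^sub>i\<^sub>0 x'\<^sub>j\<^sub>k, x'\<^sub>i\<^sub>r x'\<^sub>j\<^sub>s) = 0\<close>, again by orthogonality (\<open>abs_cov_decay\<close>). All other contributions are of order
\<open>q\<^sup>2/N\<close>. Markov's inequality turns this \<open>L\<^sup>2\<close> convergence into convergence in probability
(\<open>tendsto_in_probability_L2\<close>).\<close>

section \<open>Moment bounds and covariances\<close>

text \<open>The moment bound \<open>\<parallel>A\<parallel>\<^sub>p \<le> c\<close>. The nonnegative integral makes the bound include finiteness of the moment; the
Bochner integral of a power that is not integrable would be 0.\<close>

definition Lp_le :: "'a measure \<Rightarrow> nat \<Rightarrow> ('a \<Rightarrow> real) \<Rightarrow> real \<Rightarrow> bool" where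
  "Lp_le M p A c \<longleftrightarrow> A \<in> borel_measurable M \<and> 0 \<le> c \<and> (\<integral>\<^sup>+ \<omega>. ennreal (\<bar>A \<omega>\<bar> ^ p) \<partial>M) \<le> ennreal (c ^ p)"

lemma Lp_le_measurable: "Lp_le M p A c \<Longrightarrow> A \<in> borel_measurable M"
  by (simp add: Lp_le_def)

lemma Lp_le_nonneg: "Lp_le M p A c \<Longrightarrow> 0 \<le> c"
  by (simp add: Lp_le_def)

text \<open>The Cauchy-Schwarz inequality for \<open>\<bar>A\<bar>\<^sup>p\<close> and \<open>\<bar>B\<bar>\<^sup>p\<close>. It is used with \<open>p = 2\<close>, where fourth moments control products in
\<open>L\<^sup>2\<close>, and with \<open>p = 1\<close>.\<close>

lemma Lp_le_mult:
  assumes A: "Lp_le M (2 * p) A a" and B: "Lp_le M (2 * p) B b"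
  shows "Lp_le M p (\<lambda>\<omega>. A \<omega> * B \<omega>) (a * b)"
proof -
  have [measurable]: "A \<in> borel_measurable M" "B \<in> borel_measurable M" and ab: "0 \<le> a" "0 \<le> b"
    using A B by (auto simp: Lp_le_def)
  let ?I = "\<integral>\<^sup>+ \<omega>. ennreal (\<bar>A \<omega> * B \<omega>\<bar> ^ p) \<partial>M"
  have "?I\<^sup>2 = (\<integral>\<^sup>+ \<omega>. ennreal (\<bar>A \<omega>\<bar> ^ p) * ennreal (\<bar>B \<omega>\<bar> ^ p) \<partial>M)\<^sup>2"
    by (simp add: abs_mult power_mult_distrib ennreal_mult)
  also have "\<dots> \<le> (\<integral>\<^sup>+ \<omega>. (ennreal (\<bar>A \<omega>\<bar> ^ p))\<^sup>2 \<partial>M) * (\<integral>\<^sup>+ \<omega>. (ennreal (\<bar>B \<omega>\<bar> ^ p))\<^sup>2 \<partial>M)"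
    by (rule Cauchy_Schwarz_nn_integral) simp_all
  also have "\<dots> = (\<integral>\<^sup>+ \<omega>. ennreal (\<bar>A \<omega>\<bar> ^ (2 * p)) \<partial>M) * (\<integral>\<^sup>+ \<omega>. ennreal (\<bar>B \<omega>\<bar> ^ (2 * p)) \<partial>M)"
    by (simp add: ennreal_power power_even_eq del: power_even_abs)
  also have "\<dots> \<le> ennreal (a ^ (2 * p)) * ennreal (b ^ (2 * p))"
    using A B by (intro mult_mono) (auto simp: Lp_le_def)
  also have "\<dots> = (ennreal ((a * b) ^ p))\<^sup>2"
    using ab by (simp add: ennreal_mult[symmetric] ennreal_power power_mult_distrib power_even_eq)
  finally have "?I\<^sup>2 \<le> (ennreal ((a * b) ^ p))\<^sup>2" .
  then have "?I \<le> ennreal ((a * b) ^ p)"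
    using ab by (cases ?I) (auto simp: ennreal_power top_power_ennreal top_unique intro: power2_le_imp_le)
  then show ?thesis using ab by (simp add: Lp_le_def)
qed

lemma (in prob_space) Lp_le_const: "Lp_le M p (\<lambda>_. c) \<bar>c\<bar>"
  by (simp add: Lp_le_def emeasure_space_1)

lemma (in prob_space) Lp_le_half: "Lp_le M (2 * p) A a \<Longrightarrow> Lp_le M p A a"
  using Lp_le_mult[of M p A a "\<lambda>_. 1" 1] Lp_le_const[of "2 * p" 1] by simp

lemma Lp_le_1D:
  assumes "Lp_le M 1 A c"
  shows "integrable M A" "\<bar>LINT \<omega>|M. A \<omega>\<bar> \<le> c"
proof -
  show i: "integrable M A"
    using assms by (intro integrableI_bounded) (auto simp: Lp_le_def intro: le_less_trans[of _ "ennreal c"])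
  have "\<bar>LINT \<omega>|M. A \<omega>\<bar> \<le> (LINT \<omega>|M. \<bar>A \<omega>\<bar>)" by (rule integral_abs_bound)
  also have "\<dots> \<le> c"
    using assms i by (intro integral_real_bounded) (auto simp: Lp_le_def)
  finally show "\<bar>LINT \<omega>|M. A \<omega>\<bar> \<le> c" .
qed

text \<open>Only finiteness of the moment of a difference matters below, so \<open>\<bar>s - t\<bar> \<le> 2 max \<bar>s\<bar> \<bar>t\<bar>\<close> takes the place of Minkowski's
inequality, at the price of the factor 4.\<close>

lemma Lp_le_diff:
  assumes p: "0 < p" and A: "Lp_le M p A a" and B: "Lp_le M p B a"
  shows "Lp_le M p (\<lambda>\<omega>. A \<omega> - B \<omega>) (4 * a)"
proof -
  have [measurable]: "A \<in> borel_measurable M" "B \<in> borel_measurable M" and a: "0 \<le> a"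
    using A B by (auto simp: Lp_le_def)
  have diff: "\<bar>s - t\<bar> ^ p \<le> 2 ^ p * \<bar>s\<bar> ^ p + 2 ^ p * \<bar>t\<bar> ^ p" for s t :: real
  proof -
    have "\<bar>s - t\<bar> ^ p \<le> (2 * max \<bar>s\<bar> \<bar>t\<bar>) ^ p" by (intro power_mono) auto
    also have "\<dots> \<le> 2 ^ p * \<bar>s\<bar> ^ p + 2 ^ p * \<bar>t\<bar> ^ p"
      by (auto simp: max_def power_mult_distrib)
    finally show ?thesis .
  qed
  have "(\<integral>\<^sup>+ \<omega>. ennreal (\<bar>A \<omega> - B \<omega>\<bar> ^ p) \<partial>M) \<le>
      (\<integral>\<^sup>+ \<omega>. ennreal (2 ^ p) * ennreal (\<bar>A \<omega>\<bar> ^ p) + ennreal (2 ^ p) * ennreal (\<bar>B \<omega>\<bar> ^ p) \<partial>M)"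
    using diff by (intro nn_integral_mono) (simp add: ennreal_mult[symmetric] ennreal_plus[symmetric] del: ennreal_plus)
  also have "\<dots> = ennreal (2 ^ p) * (\<integral>\<^sup>+ \<omega>. ennreal (\<bar>A \<omega>\<bar> ^ p) \<partial>M) +
      ennreal (2 ^ p) * (\<integral>\<^sup>+ \<omega>. ennreal (\<bar>B \<omega>\<bar> ^ p) \<partial>M)"
    by (simp add: nn_integral_add nn_integral_cmult)
  also have "\<dots> \<le> ennreal (2 ^ p) * ennreal (a ^ p) + ennreal (2 ^ p) * ennreal (a ^ p)"
    using A B by (intro add_mono mult_left_mono) (auto simp: Lp_le_def)
  also have "\<dots> = ennreal (2 * 2 ^ p * a ^ p)"
    using a by (simp add: ennreal_mult[symmetric] ennreal_plus[symmetric] del: ennreal_plus)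
  also have "\<dots> \<le> ennreal ((4 * a) ^ p)"
  proof (intro ennreal_leI)
    have "(2::real) * 2 ^ p \<le> 2 ^ p * 2 ^ p"
      using p power_increasing[of 1 p "2::real"] by (intro mult_right_mono) auto
    also have "\<dots> = 4 ^ p" by (simp add: power_mult_distrib[symmetric])
    finally show "2 * 2 ^ p * a ^ p \<le> (4 * a) ^ p"
      using a by (simp add: power_mult_distrib mult_right_mono)
  qed
  finally show ?thesis using a by (simp add: Lp_le_def)
qed

lemma Lp_le_cong_AE:
  assumes "AE \<omega> in M. A \<omega> = B \<omega>" "B \<in> borel_measurable M" "Lp_le M p A c"
  shows "Lp_le M p B c"
proof -
  have "(\<integral>\<^sup>+ \<omega>. ennreal (\<bar>B \<omega>\<bar> ^ p) \<partial>M) = (\<integral>\<^sup>+ \<omega>. ennreal (\<bar>A \<omega>\<bar> ^ p) \<partial>M)"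
    using assms(1) by (intro nn_integral_cong_AE) auto
  then show ?thesis using assms by (simp add: Lp_le_def)
qed

lemma Lp_le_law:
  assumes [measurable]: "A \<in> M \<rightarrow>\<^sub>M N" "B \<in> M \<rightarrow>\<^sub>M N" "F \<in> borel_measurable N"
    and law: "distr M N A = distr M N B" and le: "Lp_le M p (\<lambda>\<omega>. F (A \<omega>)) c"
  shows "Lp_le M p (\<lambda>\<omega>. F (B \<omega>)) c"
proof -
  have "(\<integral>\<^sup>+ \<omega>. ennreal (\<bar>F (B \<omega>)\<bar> ^ p) \<partial>M) = (\<integral>\<^sup>+ s. ennreal (\<bar>F s\<bar> ^ p) \<partial>distr M N B)"
    by (simp add: nn_integral_distr)
  also have "\<dots> = (\<integral>\<^sup>+ \<omega>. ennreal (\<bar>F (A \<omega>)\<bar> ^ p) \<partial>M)"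
    unfolding law[symmetric] by (simp add: nn_integral_distr)
  finally show ?thesis using le by (simp add: Lp_le_def)
qed

lemma Lp_le_dominated:
  assumes "Lp_le M p A c" "B \<in> borel_measurable M" "\<And>\<omega>. \<omega> \<in> space M \<Longrightarrow> \<bar>B \<omega>\<bar> \<le> \<bar>A \<omega>\<bar>"
  shows "Lp_le M p B c"
proof -
  have "(\<integral>\<^sup>+ \<omega>. ennreal (\<bar>B \<omega>\<bar> ^ p) \<partial>M) \<le> (\<integral>\<^sup>+ \<omega>. ennreal (\<bar>A \<omega>\<bar> ^ p) \<partial>M)"
    using assms(3) by (intro nn_integral_mono ennreal_leI power_mono) auto
  then show ?thesis using assms(1,2) by (auto simp: Lp_le_def)
qed

lemma (in prob_space) L2_integrable: "Lp_le M 2 A c \<Longrightarrow> integrable M A"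
  using Lp_le_1D(1)[OF Lp_le_half[of 1 A c]] by simp

lemma L2_product_integrable:
  assumes "Lp_le M 2 A a" "Lp_le M 2 B b"
  shows "integrable M (\<lambda>\<omega>. A \<omega> * B \<omega>)" "\<bar>LINT \<omega>|M. A \<omega> * B \<omega>\<bar> \<le> a * b"
  using Lp_le_1D[OF Lp_le_mult[of M 1 A a B b]] assms by simp_all

context prob_space begin

lemma covariance_eq:
  assumes "Lp_le M 2 A a" "Lp_le M 2 B b"
  shows "covariance M A B = expectation (\<lambda>\<omega>. A \<omega> * B \<omega>) - expectation A * expectation B"
proof -
  have i: "integrable M (\<lambda>\<omega>. A \<omega> * B \<omega>)" "integrable M A" "integrable M B"
    using Lp_le_1D(1)[OF Lp_le_mult[of M 1 A a B b]] Lp_le_1D(1)[OF Lp_le_half[of 1 A a]]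
      Lp_le_1D(1)[OF Lp_le_half[of 1 B b]] assms by simp_all
  have "covariance M A B = expectation (\<lambda>\<omega>. A \<omega> * B \<omega> - A \<omega> * expectation B - expectation A * B \<omega>
      + expectation A * expectation B)"
    unfolding covariance_def by (rule Bochner_Integration.integral_cong) (auto simp: algebra_simps)
  also have "\<dots> = expectation (\<lambda>\<omega>. A \<omega> * B \<omega>) - expectation A * expectation B"
    using i by (simp add: prob_space)
  finally show ?thesis .
qed

lemma covariance_bound:
  assumes A: "Lp_le M 2 A a" and B: "Lp_le M 2 B b"
  shows "\<bar>covariance M A B\<bar> \<le> 2 * (a * b)"
proof -
  have "\<bar>expectation (\<lambda>\<omega>. A \<omega> * B \<omega>)\<bar> \<le> a * b"
    using Lp_le_1D(2)[OF Lp_le_mult[of M 1 A a B b]] A B by simp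
  moreover have "\<bar>expectation A\<bar> * \<bar>expectation B\<bar> \<le> a * b"
    using Lp_le_1D(2)[OF Lp_le_half[of 1 A a]] Lp_le_1D(2)[OF Lp_le_half[of 1 B b]] A B
    by (intro mult_mono) (simp_all add: Lp_le_nonneg)
  ultimately show ?thesis
    unfolding covariance_eq[OF A B] abs_mult[symmetric] by linarith
qed

lemma covariance_add_right:
  assumes A: "Lp_le M 2 A a" and B: "Lp_le M 2 B b" and C: "Lp_le M 2 C c"
  shows "covariance M A (\<lambda>\<omega>. B \<omega> + C \<omega>) = covariance M A B + covariance M A C"
proof -
  have i: "integrable M (\<lambda>\<omega>. (A \<omega> - expectation A) * (Y \<omega> - expectation Y)) \<and> integrable M Y"
    if Y: "Lp_le M 2 Y y" for Y y
  proof -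
    have j: "integrable M (\<lambda>\<omega>. A \<omega> * Y \<omega>)" "integrable M A" "integrable M Y"
      using Lp_le_1D(1)[OF Lp_le_mult[of M 1 A a Y y]] Lp_le_1D(1)[OF Lp_le_half[of 1 A a]]
        Lp_le_1D(1)[OF Lp_le_half[of 1 Y y]] A Y by simp_all
    have "integrable M (\<lambda>\<omega>. A \<omega> * Y \<omega> - A \<omega> * expectation Y - expectation A * Y \<omega> + expectation A * expectation Y)"
      using j by simp
    then show ?thesis using j by (simp add: algebra_simps)
  qed
  have "covariance M A (\<lambda>\<omega>. B \<omega> + C \<omega>) = expectation (\<lambda>\<omega>. (A \<omega> - expectation A) * (B \<omega> - expectation B)
     + (A \<omega> - expectation A) * (C \<omega> - expectation C))"
    unfolding covariance_def using i[OF B] i[OF C]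
    by (intro Bochner_Integration.integral_cong) (auto simp: algebra_simps)
  then show ?thesis using i[OF B] i[OF C] by (simp add: covariance_def)
qed

lemma covariance_commute: "covariance M A B = covariance M B A"
  by (simp add: covariance_def mult.commute)

lemma covariance_cong_AE:
  assumes "AE \<omega> in M. A \<omega> = A' \<omega>" "AE \<omega> in M. B \<omega> = B' \<omega>"
    and [measurable]: "A \<in> borel_measurable M" "A' \<in> borel_measurable M" "B \<in> borel_measurable M" "B' \<in> borel_measurable M"
  shows "covariance M A B = covariance M A' B'"
proof -
  have e: "expectation A = expectation A'" "expectation B = expectation B'"
    using assms by (auto intro!: integral_cong_AE)
  show ?thesis
    unfolding covariance_def e by (rule integral_cong_AE) (use assms in \<open>auto\<close>)
qed

end

section \<open>The Hilbert space of square integrable functions\<close>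

lemma H_carrier_Lp_le: "g \<in> H_carrier \<Longrightarrow> Lp_le unit_lborel 2 g (H_norm g)"
  unfolding H_carrier_def Lp_le_def H_norm_def
  by (auto simp: nn_integral_eq_integral)

lemma H_inner_bound:
  assumes "g \<in> H_carrier" "v \<in> H_carrier"
  shows "integrable unit_lborel (\<lambda>t. g t * v t)" "\<bar>H_inner g v\<bar> \<le> H_norm g * H_norm v"
  using Lp_le_1D[OF Lp_le_mult[of unit_lborel 1 g _ v], of "H_norm g" "H_norm v"]
    H_carrier_Lp_le[OF assms(1)] H_carrier_Lp_le[OF assms(2)]
  by (simp_all add: H_inner_def)

lemma H_norm_sq: "(H_norm g)\<^sup>2 = (LINT t|unit_lborel. (g t)\<^sup>2)"
  by (simp add: H_norm_def)

lemma H_norm_nonneg: "0 \<le> H_norm g"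
  by (simp add: H_norm_def)

lemma H_carrier_diff:
  assumes "g \<in> H_carrier" "h \<in> H_carrier"
  shows "(\<lambda>t. g t - h t) \<in> H_carrier"
proof -
  have "integrable unit_lborel (\<lambda>t. (g t)\<^sup>2 - 2 * (g t * h t) + (h t)\<^sup>2)"
    using assms H_inner_bound(1)[OF assms] by (simp add: H_carrier_def)
  then show ?thesis
    using assms by (auto simp: H_carrier_def power2_diff algebra_simps)
qed

lemma H_inner_diff:
  assumes "g \<in> H_carrier" "h \<in> H_carrier" "v \<in> H_carrier"
  shows "H_inner g v - H_inner h v = H_inner (\<lambda>t. g t - h t) v"
  using H_inner_bound(1)[OF assms(1,3)] H_inner_bound(1)[OF assms(2,3)]
  by (simp add: H_inner_def left_diff_distrib)

lemma H_norm_triangle: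
  assumes g: "g \<in> H_carrier" and h: "h \<in> H_carrier"
  shows "H_norm (\<lambda>t. g t - h t) \<le> H_norm g + H_norm h"
proof -
  have "(H_norm (\<lambda>t. g t - h t))\<^sup>2 = (LINT t|unit_lborel. (g t)\<^sup>2 - 2 * (g t * h t) + (h t)\<^sup>2)"
    by (simp add: H_norm_sq power2_diff algebra_simps)
  also have "\<dots> = (H_norm g)\<^sup>2 - 2 * H_inner g h + (H_norm h)\<^sup>2"
    using g h H_inner_bound(1)[OF g h] by (simp add: H_norm_sq H_inner_def H_carrier_def)
  also have "\<dots> \<le> (H_norm g + H_norm h)\<^sup>2"
    using H_inner_bound(2)[OF g h] by (simp add: power2_sum)
  finally show ?thesis
    by (rule power2_le_imp_le) (simp add: H_norm_nonneg)
qed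

lemma space_H_borel: "space H_borel = H_carrier"
  unfolding H_borel_def by (rule space_measure_of) (auto simp: H_open_def)

text \<open>The \<open>\<sigma>\<close>-algebra is generated by the norm-open sets, and a Lipschitz functional has norm-open superlevel sets.\<close>

lemma H_continuous_measurable:
  assumes lip: "\<And>g h. g \<in> H_carrier \<Longrightarrow> h \<in> H_carrier \<Longrightarrow> F g - F h \<le> L * H_norm (\<lambda>t. h t - g t)"
    and L: "0 \<le> L"
  shows "(F :: (real \<Rightarrow> real) \<Rightarrow> real) \<in> borel_measurable H_borel"
proof (unfold borel_measurable_iff_greater, intro allI)
  fix c
  have "H_open {g \<in> H_carrier. c < F g}"
    unfolding H_open_def
  proof (intro conjI ballI)
    fix g assume g: "g \<in> {g \<in> H_carrier. c < F g}"
    show "\<exists>e>0. \<forall>h\<in>H_carrier. H_norm (\<lambda>t. h t - g t) < e \<longrightarrow> h \<in> {g \<in> H_carrier. c < F g}"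
    proof (intro exI[of _ "(F g - c) / (L + 1)"] conjI ballI impI)
      show "0 < (F g - c) / (L + 1)" using g L by simp
      fix h assume h: "h \<in> H_carrier" and d: "H_norm (\<lambda>t. h t - g t) < (F g - c) / (L + 1)"
      have "F g - F h \<le> (L + 1) * H_norm (\<lambda>t. h t - g t)"
        using lip[of g h] g h H_norm_nonneg[of "\<lambda>t. h t - g t"] by (simp add: distrib_right)
      also have "\<dots> < F g - c" using d L by (simp add: field_simps)
      finally show "h \<in> {g \<in> H_carrier. c < F g}" using h by simp
    qed
  qed auto
  then show "{g \<in> space H_borel. c < F g} \<in> sets H_borel"
    unfolding space_H_borel unfolding H_borel_def
    by (subst sets_measure_of) (auto simp: H_open_def)
qed

lemma H_inner_measurable:
  assumes v: "v \<in> H_carrier"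
  shows "(\<lambda>g. H_inner g v) \<in> borel_measurable H_borel"
proof (rule H_continuous_measurable[where L = "H_norm v"])
  fix g h assume gh: "g \<in> H_carrier" "h \<in> H_carrier"
  have "H_inner g v - H_inner h v = - H_inner (\<lambda>t. h t - g t) v"
    using H_inner_diff[OF gh(2,1) v] by simp
  then show "H_inner g v - H_inner h v \<le> H_norm v * H_norm (\<lambda>t. h t - g t)"
    using H_inner_bound(2)[OF H_carrier_diff[OF gh(2,1)] v] by (simp add: mult.commute)
qed (rule H_norm_nonneg)

lemma H_norm_measurable: "H_norm \<in> borel_measurable H_borel"
proof (rule H_continuous_measurable[where L = 1])
  fix g h assume gh: "g \<in> H_carrier" "h \<in> H_carrier"
  have "H_norm (\<lambda>t. h t - (h t - g t)) \<le> H_norm h + H_norm (\<lambda>t. h t - g t)"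
    by (intro H_norm_triangle H_carrier_diff gh)
  then show "H_norm g - H_norm h \<le> 1 * H_norm (\<lambda>t. h t - g t)" by simp
qed simp

text \<open>Pathwise domination by the norm of \<open>D\<close> carries the moment bound over to \<open>A\<close>, since the nonnegative integral is monotone. In
the application \<open>D\<close> is the coupling error, a difference of two random elements of \<open>H\<close>, and \<open>A\<close> is a difference of
scores.\<close>

lemma Lp_le_nu:
  assumes A: "A \<in> borel_measurable M" and AD: "\<And>\<omega>. \<omega> \<in> space M \<Longrightarrow> \<bar>A \<omega>\<bar> \<le> H_norm (D \<omega>)"
    and fin: "(\<integral>\<^sup>+ \<omega>. ennreal (H_norm (D \<omega>) powr real p) \<partial>M) < \<infinity>" and p: "0 < p"
  shows "Lp_le M p A (nu M p D)"
proof -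
  let ?I = "\<integral>\<^sup>+ \<omega>. ennreal (H_norm (D \<omega>) powr real p) \<partial>M"
  have "(nu M p D) ^ p = enn2real ?I"
    using p by (simp add: nu_def powr_realpow'[symmetric] powr_powr)
  then have "ennreal ((nu M p D) ^ p) = ?I"
    using fin by (simp add: ennreal_enn2real)
  moreover have "(\<integral>\<^sup>+ \<omega>. ennreal (\<bar>A \<omega>\<bar> ^ p) \<partial>M) \<le> ?I"
    using AD p by (intro nn_integral_mono ennreal_leI) (simp add: powr_realpow' H_norm_nonneg power_mono)
  ultimately show ?thesis
    using A by (simp add: Lp_le_def nu_def)
qed

lemma sigma_finite_unit_lborel: "sigma_finite_measure unit_lborel"
  unfolding unit_lborel_def
  by (intro sigma_finite_measure_restrict_space lborel.sigma_finite_measure_axioms) simp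

text \<open>By Fubini's theorem the expectation of \<open>\<integral> Z(t) v(t) dt\<close> is \<open>\<integral> E Z(t) v(t) dt\<close>. The product is integrable on the product space
because, for each \<open>\<omega>\<close>, the Cauchy-Schwarz inequality bounds the inner integral by \<open>\<parallel>Z(\<omega>)\<parallel> \<parallel>v\<parallel>\<close>.\<close>

lemma expectation_H_inner_zero:
  assumes "prob_space M" and Z: "Z \<in> LpH M 2" and v: "v \<in> H_carrier"
    and joint: "(\<lambda>(t, \<omega>). Z \<omega> t) \<in> borel_measurable (unit_lborel \<Otimes>\<^sub>M M)"
    and mean: "AE t in unit_lborel. (LINT \<omega>|M. Z \<omega> t) = 0"
  shows "(LINT \<omega>|M. H_inner (Z \<omega>) v) = 0"
proof -
  interpret prob_space M by fact
  interpret U: sigma_finite_measure unit_lborel by (rule sigma_finite_unit_lborel)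
  interpret UM: pair_sigma_finite unit_lborel M ..
  have Zm: "Z \<in> M \<rightarrow>\<^sub>M H_borel" and fin: "(\<integral>\<^sup>+ \<omega>. ennreal (H_norm (Z \<omega>) powr real 2) \<partial>M) < \<infinity>"
    using Z by (auto simp: LpH_def)
  have carrier: "Z \<omega> \<in> H_carrier" if "\<omega> \<in> space M" for \<omega>
    using measurable_space[OF Zm that] by (simp add: space_H_borel)
  have "Lp_le M 2 (\<lambda>\<omega>. H_norm (Z \<omega>)) (nu M 2 Z)"
    using Lp_le_nu[of "\<lambda>\<omega>. H_norm (Z \<omega>)" M Z 2] fin measurable_compose[OF Zm H_norm_measurable]
    by (simp add: H_norm_nonneg)
  then have norm1: "Lp_le M 1 (\<lambda>\<omega>. H_norm (Z \<omega>)) (nu M 2 Z)"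
    using Lp_le_half[of 1] by simp
  have vm: "v \<in> borel_measurable unit_lborel" using v by (simp add: H_carrier_def)
  have meas [measurable]: "(\<lambda>(t, \<omega>). Z \<omega> t * v t) \<in> borel_measurable (unit_lborel \<Otimes>\<^sub>M M)"
  proof -
    have "(\<lambda>p. v (fst p)) \<in> borel_measurable (unit_lborel \<Otimes>\<^sub>M M)"
      by (rule measurable_compose[OF measurable_fst vm])
    from borel_measurable_times[OF joint this] show ?thesis by (simp add: case_prod_beta')
  qed
  have "(\<integral>\<^sup>+ p. ennreal (norm (case p of (t, \<omega>) \<Rightarrow> Z \<omega> t * v t)) \<partial>(unit_lborel \<Otimes>\<^sub>M M)) =
      (\<integral>\<^sup>+ \<omega>. \<integral>\<^sup>+ t. ennreal \<bar>Z \<omega> t * v t\<bar> \<partial>unit_lborel \<partial>M)"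
    by (subst UM.nn_integral_snd[symmetric]) (simp_all add: case_prod_beta')
  also have "\<dots> \<le> (\<integral>\<^sup>+ \<omega>. ennreal (H_norm (Z \<omega>) * H_norm v) \<partial>M)"
  proof (intro nn_integral_mono)
    fix \<omega> assume "\<omega> \<in> space M"
    from Lp_le_mult[of unit_lborel 1, simplified, OF H_carrier_Lp_le[OF carrier[OF this]] H_carrier_Lp_le[OF v]]
    show "(\<integral>\<^sup>+ t. ennreal \<bar>Z \<omega> t * v t\<bar> \<partial>unit_lborel) \<le> ennreal (H_norm (Z \<omega>) * H_norm v)"
      by (simp add: Lp_le_def)
  qed
  also have "\<dots> < \<infinity>"
    using Lp_le_1D(1)[OF norm1]
    by (simp add: nn_integral_eq_integral H_norm_nonneg)
  finally have "integrable (unit_lborel \<Otimes>\<^sub>M M) (\<lambda>(t, \<omega>). Z \<omega> t * v t)"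
    by (intro integrableI_bounded meas)
  from UM.Fubini_integral[OF this]
  have "(LINT \<omega>|M. H_inner (Z \<omega>) v) = (LINT t|unit_lborel. (LINT \<omega>|M. Z \<omega> t * v t))"
    by (simp add: H_inner_def)
  also have "\<dots> = (LINT t|unit_lborel. (LINT \<omega>|M. Z \<omega> t) * v t)" by simp
  also have "\<dots> = 0"
    using mean by (intro integral_eq_zero_AE) auto
  finally show ?thesis .
qed

section \<open>Independence of pairs\<close>

text \<open>Independence in terms of the joint law. The two components may have different types here, whereas \<open>indep_var\<close> takes both
from the same type.\<close>

definition indep_pair :: "'w measure \<Rightarrow> 'a measure \<Rightarrow> ('w \<Rightarrow> 'a) \<Rightarrow> 'b measure \<Rightarrow> ('w \<Rightarrow> 'b) \<Rightarrow> bool" where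
  "indep_pair M MA A MB B \<longleftrightarrow> A \<in> measurable M MA \<and> B \<in> measurable M MB \<and>
     distr M MA A \<Otimes>\<^sub>M distr M MB B = distr M (MA \<Otimes>\<^sub>M MB) (\<lambda>\<omega>. (A \<omega>, B \<omega>))"

lemma (in prob_space) indep_var_iff_indep_pair:
  "indep_var MA A MB B \<longleftrightarrow> indep_pair M MA A MB B"
  unfolding indep_pair_def indep_var_distribution_eq ..

lemma (in prob_space) indep_pair_compose:
  assumes AB: "indep_pair M MA A MB B" and f: "f \<in> MA \<rightarrow>\<^sub>M NA" and g: "g \<in> MB \<rightarrow>\<^sub>M NB"
  shows "indep_pair M NA (\<lambda>\<omega>. f (A \<omega>)) NB (\<lambda>\<omega>. g (B \<omega>))"
proof -
  have [measurable]: "A \<in> M \<rightarrow>\<^sub>M MA" "B \<in> M \<rightarrow>\<^sub>M MB"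
    using AB by (auto simp: indep_pair_def)
  note [measurable] = f g
  interpret B: prob_space "distr (distr M MB B) NB g"
    by (intro prob_space.prob_space_distr prob_space_distr) simp_all
  have "distr M NA (\<lambda>\<omega>. f (A \<omega>)) \<Otimes>\<^sub>M distr M NB (\<lambda>\<omega>. g (B \<omega>)) =
      distr (distr M MA A) NA f \<Otimes>\<^sub>M distr (distr M MB B) NB g"
    by (simp add: distr_distr comp_def)
  also have "\<dots> = distr (distr M MA A \<Otimes>\<^sub>M distr M MB B) (NA \<Otimes>\<^sub>M NB) (\<lambda>(x, y). (f x, g y))"
    by (rule pair_measure_distr) (simp_all add: B.sigma_finite_measure_axioms)
  also have "\<dots> = distr (distr M (MA \<Otimes>\<^sub>M MB) (\<lambda>\<omega>. (A \<omega>, B \<omega>))) (NA \<Otimes>\<^sub>M NB) (\<lambda>(x, y). (f x, g y))"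
    using AB by (simp add: indep_pair_def)
  also have "\<dots> = distr M (NA \<Otimes>\<^sub>M NB) (\<lambda>\<omega>. (f (A \<omega>), g (B \<omega>)))"
    by (subst distr_distr) (simp_all add: comp_def)
  finally show ?thesis by (simp add: indep_pair_def)
qed

text \<open>The hypotheses say that the law of \<open>((U, A), C)\<close> is the product of the three marginal laws. Integrals with respect to this law and
to the product of the laws of \<open>U\<close>, \<open>A\<close> and \<open>C\<close> bracketed the other way are the same iterated integrals, by Tonelli's theorem.\<close>

lemma (in prob_space) indep_pair_regroup:
  assumes UA: "indep_pair M MU U MA A"
    and UAC: "indep_pair M (MU \<Otimes>\<^sub>M MA) (\<lambda>\<omega>. (U \<omega>, A \<omega>)) MC C"
  shows "indep_pair M MU U (MA \<Otimes>\<^sub>M MC) (\<lambda>\<omega>. (A \<omega>, C \<omega>))"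
proof -
  have [measurable]: "U \<in> measurable M MU" "A \<in> measurable M MA" "C \<in> measurable M MC"
    using UA UAC by (auto simp: indep_pair_def)
  let ?U = "distr M MU U" and ?A = "distr M MA A" and ?C = "distr M MC C"
  interpret U: prob_space ?U by (rule prob_space_distr) simp
  interpret A: prob_space ?A by (rule prob_space_distr) simp
  interpret C: prob_space ?C by (rule prob_space_distr) simp
  interpret AC: pair_prob_space ?A ?C ..
  have joint: "distr M (MU \<Otimes>\<^sub>M MA) (\<lambda>\<omega>. (U \<omega>, A \<omega>)) = ?U \<Otimes>\<^sub>M ?A"
    "distr M ((MU \<Otimes>\<^sub>M MA) \<Otimes>\<^sub>M MC) (\<lambda>\<omega>. ((U \<omega>, A \<omega>), C \<omega>)) = (?U \<Otimes>\<^sub>M ?A) \<Otimes>\<^sub>M ?C"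
    using UA UAC by (simp_all add: indep_pair_def)
  have "?U \<Otimes>\<^sub>M (?A \<Otimes>\<^sub>M ?C) = distr M (MU \<Otimes>\<^sub>M (MA \<Otimes>\<^sub>M MC)) (\<lambda>\<omega>. (U \<omega>, A \<omega>, C \<omega>))"
  proof (rule measure_eqI)
    show "sets (?U \<Otimes>\<^sub>M (?A \<Otimes>\<^sub>M ?C)) = sets (distr M (MU \<Otimes>\<^sub>M (MA \<Otimes>\<^sub>M MC)) (\<lambda>\<omega>. (U \<omega>, A \<omega>, C \<omega>)))"
      by (simp cong: sets_pair_measure_cong)
    fix B assume "B \<in> sets (?U \<Otimes>\<^sub>M (?A \<Otimes>\<^sub>M ?C))"
    then have B: "B \<in> sets (MU \<Otimes>\<^sub>M (MA \<Otimes>\<^sub>M MC))"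
      by (simp cong: sets_pair_measure_cong)
    \<comment> \<open>The indicator of \<open>B\<close> in curried form, ready for iterated integrals.\<close>
    define h where "h = (\<lambda>u a c. indicator B (u, a, c) :: ennreal)"
    have hm [measurable]: "(\<lambda>(u, a, c). h u a c) \<in> borel_measurable (MU \<Otimes>\<^sub>M (MA \<Otimes>\<^sub>M MC))"
      unfolding h_def using B by (simp add: case_prod_beta')
    have h3 [measurable]: "(\<lambda>p. h (fst (fst p)) (snd (fst p)) (snd p)) \<in> borel_measurable ((MU \<Otimes>\<^sub>M MA) \<Otimes>\<^sub>M MC)"
    proof -
      have "(\<lambda>p. (fst (fst p), snd (fst p), snd p)) \<in> (MU \<Otimes>\<^sub>M MA) \<Otimes>\<^sub>M MC \<rightarrow>\<^sub>M MU \<Otimes>\<^sub>M (MA \<Otimes>\<^sub>M MC)"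
        by measurable
      from measurable_compose[OF this hm] show ?thesis by simp
    qed
    have "emeasure (?U \<Otimes>\<^sub>M (?A \<Otimes>\<^sub>M ?C)) B = (\<integral>\<^sup>+ p. (case p of (u, a, c) \<Rightarrow> h u a c) \<partial>(?U \<Otimes>\<^sub>M (?A \<Otimes>\<^sub>M ?C)))"
      using B by (simp add: h_def case_prod_beta' cong: sets_pair_measure_cong)
    also have "\<dots> = (\<integral>\<^sup>+ u. \<integral>\<^sup>+ q. (case q of (a, c) \<Rightarrow> h u a c) \<partial>(?A \<Otimes>\<^sub>M ?C) \<partial>?U)"
      by (subst sigma_finite_measure.nn_integral_fst[OF AC.sigma_finite_measure_axioms, symmetric]) (simp_all add: hm cong: measurable_cong_sets sets_pair_measure_cong)
    also have "\<dots> = (\<integral>\<^sup>+ u. \<integral>\<^sup>+ a. \<integral>\<^sup>+ c. h u a c \<partial>?C \<partial>?A \<partial>?U)"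
    proof (intro nn_integral_cong)
      fix u assume u: "u \<in> space ?U"
      have "(\<lambda>q. (u, q)) \<in> (MA \<Otimes>\<^sub>M MC) \<rightarrow>\<^sub>M MU \<Otimes>\<^sub>M (MA \<Otimes>\<^sub>M MC)" using u by simp
      from measurable_compose[OF this hm]
      have "(\<lambda>(a, c). h u a c) \<in> borel_measurable (?A \<Otimes>\<^sub>M ?C)"
        by (simp cong: measurable_cong_sets sets_pair_measure_cong)
      from C.nn_integral_fst[OF this]
      show "(\<integral>\<^sup>+ q. (case q of (a, c) \<Rightarrow> h u a c) \<partial>(?A \<Otimes>\<^sub>M ?C)) = (\<integral>\<^sup>+ a. \<integral>\<^sup>+ c. h u a c \<partial>?C \<partial>?A)"
        by simp
    qed
    also have "\<dots> = (\<integral>\<^sup>+ q. \<integral>\<^sup>+ c. h (fst q) (snd q) c \<partial>?C \<partial>(?U \<Otimes>\<^sub>M ?A))"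
    proof -
      have "(\<lambda>q. \<integral>\<^sup>+ c. h (fst q) (snd q) c \<partial>?C) \<in> borel_measurable (?U \<Otimes>\<^sub>M ?A)"
        by (rule C.borel_measurable_nn_integral) (use h3 in \<open>simp add: case_prod_beta' cong: measurable_cong_sets sets_pair_measure_cong\<close>)
      from A.nn_integral_fst[OF this] show ?thesis by simp
    qed
    also have "\<dots> = (\<integral>\<^sup>+ p. h (fst (fst p)) (snd (fst p)) (snd p) \<partial>((?U \<Otimes>\<^sub>M ?A) \<Otimes>\<^sub>M ?C))"
      by (subst C.nn_integral_fst[symmetric]) (use h3 in \<open>simp_all cong: measurable_cong_sets sets_pair_measure_cong\<close>)
    also have "\<dots> = (\<integral>\<^sup>+ \<omega>. h (U \<omega>) (A \<omega>) (C \<omega>) \<partial>M)"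
      unfolding joint(2)[symmetric] by (subst nn_integral_distr) (use h3 in \<open>simp_all\<close>)
    also have "\<dots> = emeasure (distr M (MU \<Otimes>\<^sub>M (MA \<Otimes>\<^sub>M MC)) (\<lambda>\<omega>. (U \<omega>, A \<omega>, C \<omega>))) B"
      using B by (simp add: h_def nn_integral_distr[symmetric] flip: nn_integral_indicator)
        (subst nn_integral_distr; simp)
    finally show "emeasure (?U \<Otimes>\<^sub>M (?A \<Otimes>\<^sub>M ?C)) B = emeasure (distr M (MU \<Otimes>\<^sub>M (MA \<Otimes>\<^sub>M MC)) (\<lambda>\<omega>. (U \<omega>, A \<omega>, C \<omega>))) B" .
  qed
  moreover have "distr M (MA \<Otimes>\<^sub>M MC) (\<lambda>\<omega>. (A \<omega>, C \<omega>)) = ?A \<Otimes>\<^sub>M ?C"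
    using indep_pair_compose[OF UAC, where f=snd and g="\<lambda>x. x"] by (simp add: indep_pair_def)
  ultimately show ?thesis
    by (simp add: indep_pair_def)
qed

section \<open>Innovations and their independent copies\<close>

locale coupled_innovations = prob_space M for M :: "'w measure" +
  fixes S :: "'s measure" and \<epsilon> :: "int \<Rightarrow> 'w \<Rightarrow> 's" and \<epsilon>c :: "int \<Rightarrow> int \<Rightarrow> 'w \<Rightarrow> 's"
  assumes iid: "iid_seq M S \<epsilon>" and copies_indep: "independent_copies M S \<epsilon> \<epsilon>c"
begin

text \<open>The innovations are split at time 0 and each half is listed by increasing distance from it. Then \<open>X\<^sub>0\<close> is a function of
\<open>past\<close>, and the coupled variables are functions of \<open>future\<close> and \<open>copies\<close>.\<close>

definition past :: "'w \<Rightarrow> nat \<Rightarrow> 's" where "past \<omega> = (\<lambda>i. \<epsilon> (- int i) \<omega>)"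
definition future :: "'w \<Rightarrow> nat \<Rightarrow> 's" where "future \<omega> = (\<lambda>i. \<epsilon> (int (Suc i)) \<omega>)"
definition copies :: "'w \<Rightarrow> int \<Rightarrow> int \<Rightarrow> 's" where "copies \<omega> = (\<lambda>n k. \<epsilon>c n k \<omega>)"
definition past_copy :: "nat \<Rightarrow> (int \<Rightarrow> int \<Rightarrow> 's) \<Rightarrow> nat \<Rightarrow> 's" where
  "past_copy k c = (\<lambda>i. c (int k) (- int i))"
text \<open>The innovations that enter \<open>X\<^sub>k\<close>, newest first: those at times \<open>k, \<dots>, 1\<close>, then the sequence \<open>pa\<close>. With
\<open>pa = past \<omega>\<close> this is the argument of \<open>f\<close> in \<open>X\<^sub>k\<close>, and with the \<open>k\<close>-th copy of the past it is the argument in the coupled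
variable.\<close>

definition splice :: "nat \<Rightarrow> (nat \<Rightarrow> 's) \<Rightarrow> (nat \<Rightarrow> 's) \<Rightarrow> nat \<Rightarrow> 's" where
  "splice k fu pa = (\<lambda>i. if i < k then fu (k - 1 - i) else pa (i - k))"

abbreviation Seq :: "(nat \<Rightarrow> 's) measure" where "Seq \<equiv> PiM UNIV (\<lambda>_. S)"
abbreviation Dbl :: "(int \<Rightarrow> 's) measure" where "Dbl \<equiv> PiM UNIV (\<lambda>_. S)"
abbreviation Cop :: "(int \<Rightarrow> int \<Rightarrow> 's) measure" where "Cop \<equiv> PiM UNIV (\<lambda>_. Dbl)"

lemma measurable_into_PiM_UNIV:
  assumes "\<And>i. (\<lambda>\<omega>. X \<omega> i) \<in> N \<rightarrow>\<^sub>M K i"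
  shows "X \<in> N \<rightarrow>\<^sub>M PiM UNIV K"
  by (rule measurable_PiM_single')
    (use assms in \<open>auto simp: PiE_def extensional_def Pi_def dest: measurable_space\<close>)

lemma eps_measurable [measurable]: "\<epsilon> k \<in> M \<rightarrow>\<^sub>M S"
  using iid by (auto simp: iid_seq_def indep_vars_def)

lemma copies_measurable [measurable]: "copies \<in> M \<rightarrow>\<^sub>M Cop"
proof (rule measurable_into_PiM_UNIV)
  fix n
  have "\<And>c. (\<lambda>\<omega> k. case c of None \<Rightarrow> \<epsilon> k \<omega> | Some n \<Rightarrow> \<epsilon>c n k \<omega>) \<in> M \<rightarrow>\<^sub>M Dbl"
    using copies_indep by (auto simp: independent_copies_def indep_vars_def)
  from this[of "Some n"] show "(\<lambda>\<omega>. copies \<omega> n) \<in> M \<rightarrow>\<^sub>M Dbl"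
    by (simp add: copies_def)
qed

lemma eps_path_measurable [measurable]: "(\<lambda>\<omega> k. \<epsilon> (\<tau> k) \<omega>) \<in> M \<rightarrow>\<^sub>M PiM UNIV (\<lambda>_. S)"
  by (rule measurable_into_PiM_UNIV) simp

lemma past_measurable [measurable]: "past \<in> M \<rightarrow>\<^sub>M Seq"
  unfolding past_def by simp

lemma future_measurable [measurable]: "future \<in> M \<rightarrow>\<^sub>M Seq"
  unfolding future_def by (rule measurable_into_PiM_UNIV) simp

lemma past_copy_measurable [measurable]: "past_copy k \<in> Cop \<rightarrow>\<^sub>M Seq"
  unfolding past_copy_def
proof (rule measurable_into_PiM_UNIV)
  fix i :: nat
  show "(\<lambda>c. c (int k) (- int i)) \<in> Cop \<rightarrow>\<^sub>M S"
    using measurable_compose[OF measurable_component_singleton[of "int k" UNIV "\<lambda>_. Dbl"]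
        measurable_component_singleton[of "- int i" UNIV "\<lambda>_. S"]] by simp
qed

lemma splice_measurable [measurable]:
  "(\<lambda>q. splice k (fst q) (snd q)) \<in> Seq \<Otimes>\<^sub>M Seq \<rightarrow>\<^sub>M Seq"
  unfolding splice_def by (rule measurable_into_PiM_UNIV) simp

lemma window_eq_splice: "(\<lambda>a. \<epsilon> (int k - int a) \<omega>) = splice k (future \<omega>) (past \<omega>)"
  by (auto simp: splice_def future_def past_def fun_eq_iff algebra_simps of_nat_diff
      intro!: arg_cong[where f="\<lambda>z. \<epsilon> z \<omega>"])

lemma coupled_eq_splice:
  "coupled h \<epsilon> \<epsilon>c (int k) k \<omega> = h (splice k (future \<omega>) (past_copy k (copies \<omega>)))"
  unfolding coupled_def
  by (rule arg_cong[where f=h]) (auto simp: splice_def future_def past_copy_def copies_def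
      fun_eq_iff algebra_simps of_nat_diff intro!: arg_cong[where f="\<lambda>z. \<epsilon> z \<omega>"] arg_cong[where f="\<lambda>z. \<epsilon>c k z \<omega>"])

lemma indep_eps_disjoint:
  assumes "A \<inter> B = {}"
  shows "indep_pair M (PiM A (\<lambda>_. S)) (\<lambda>\<omega>. restrict (\<lambda>i. \<epsilon> i \<omega>) A)
      (PiM B (\<lambda>_. S)) (\<lambda>\<omega>. restrict (\<lambda>i. \<epsilon> i \<omega>) B)"
proof -
  have "indep_vars (\<lambda>_. S) \<epsilon> UNIV" using iid by (simp add: iid_seq_def)
  from indep_var_restrict[OF this assms] show ?thesis
    by (simp add: indep_var_iff_indep_pair)
qed

lemma past_coordinates_measurable: "(\<lambda>x i. x (- int i)) \<in> PiM {..0::int} (\<lambda>_. S) \<rightarrow>\<^sub>M Seq"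
  by (rule measurable_into_PiM_UNIV) simp

lemma future_coordinates_measurable: "(\<lambda>x i. x (int (Suc i))) \<in> PiM {0::int<..} (\<lambda>_. S) \<rightarrow>\<^sub>M Seq"
  by (rule measurable_into_PiM_UNIV) (rule measurable_component_singleton, simp)

lemma indep_past_future:
  "indep_pair M Seq past Seq future" "indep_pair M Seq future Seq past"
  using indep_pair_compose[OF indep_eps_disjoint past_coordinates_measurable future_coordinates_measurable]
    indep_pair_compose[OF indep_eps_disjoint future_coordinates_measurable past_coordinates_measurable]
  by (simp_all add: past_def [abs_def] future_def [abs_def] disjoint_iff)

lemma indep_eps_copies: "indep_pair M Dbl (\<lambda>\<omega> k. \<epsilon> k \<omega>) Cop copies"
proof -
  define Y where "Y = (\<lambda>c \<omega> k. case c of None \<Rightarrow> \<epsilon> k \<omega> | Some n \<Rightarrow> \<epsilon>c n k \<omega>)"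
  have "indep_vars (\<lambda>_. Dbl) Y UNIV"
    using copies_indep by (simp add: independent_copies_def Y_def)
  then have "indep_var (PiM {None} (\<lambda>_. Dbl)) (\<lambda>\<omega>. restrict (\<lambda>i. Y i \<omega>) {None})
      (PiM (range Some) (\<lambda>_. Dbl)) (\<lambda>\<omega>. restrict (\<lambda>i. Y i \<omega>) (range Some))"
    by (rule indep_var_restrict) auto
  then have ind: "indep_pair M (PiM {None} (\<lambda>_. Dbl)) (\<lambda>\<omega>. restrict (\<lambda>i. Y i \<omega>) {None})
      (PiM (range Some) (\<lambda>_. Dbl)) (\<lambda>\<omega>. restrict (\<lambda>i. Y i \<omega>) (range Some))"
    by (simp add: indep_var_iff_indep_pair)
  have 1: "(\<lambda>x. x None) \<in> PiM {None :: int option} (\<lambda>_. Dbl) \<rightarrow>\<^sub>M Dbl"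
    by (rule measurable_component_singleton) simp
  have 2: "(\<lambda>x n. x (Some n)) \<in> PiM (range (Some :: int \<Rightarrow> int option)) (\<lambda>_. Dbl) \<rightarrow>\<^sub>M Cop"
    by (rule measurable_into_PiM_UNIV) (rule measurable_component_singleton, simp)
  show ?thesis
    using indep_pair_compose[OF ind 1 2] by (simp add: copies_def [abs_def] Y_def)
qed

text \<open>Innovations at times \<open>\<le> 0\<close> are independent of those at times \<open>\<ge> 1\<close>, and all of them are independent of the copies.\<close>

lemma past_indep_future_copies:
  "indep_pair M Seq past (Seq \<Otimes>\<^sub>M Cop) (\<lambda>\<omega>. (future \<omega>, copies \<omega>))"
proof (rule indep_pair_regroup[OF indep_past_future(1)])
  have 1: "(\<lambda>e. (\<lambda>i. e (- int i), \<lambda>i. e (int (Suc i)))) \<in> Dbl \<rightarrow>\<^sub>M Seq \<Otimes>\<^sub>M Seq"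
    by (intro measurable_Pair measurable_into_PiM_UNIV measurable_component_singleton) auto
  show "indep_pair M (Seq \<Otimes>\<^sub>M Seq) (\<lambda>\<omega>. (past \<omega>, future \<omega>)) Cop copies"
    using indep_pair_compose[OF indep_eps_copies 1 measurable_ident]
    by (simp add: past_def future_def)
qed

lemma law_past_copy: "distr M Seq (\<lambda>\<omega>. past_copy k (copies \<omega>)) = distr M Seq past"
proof -
  have 1: "(\<lambda>e i. e (- int i)) \<in> Dbl \<rightarrow>\<^sub>M Seq"
    by (intro measurable_into_PiM_UNIV) simp
  have [measurable]: "(\<lambda>\<omega> j. \<epsilon>c (int k) j \<omega>) \<in> M \<rightarrow>\<^sub>M Dbl"
    using measurable_compose[OF copies_measurable measurable_component_singleton[of "int k" UNIV "\<lambda>_. Dbl"]]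
    by (simp add: copies_def)
  have "distr (distr M Dbl (\<lambda>\<omega> j. \<epsilon>c (int k) j \<omega>)) Seq (\<lambda>e i. e (- int i)) =
      distr (distr M Dbl (\<lambda>\<omega> j. \<epsilon> j \<omega>)) Seq (\<lambda>e i. e (- int i))"
    using copies_indep by (simp add: independent_copies_def)
  then show ?thesis
    by (simp add: distr_distr[OF 1] comp_def past_def[abs_def] past_copy_def copies_def)
qed

text \<open>The past and its copy have the same law, and both are independent of the future; so exchanging them leaves the law of the
spliced sequence unchanged. Hence coupled variables have the moments of the original ones.\<close>

lemma law_coupled: "distr M Seq (\<lambda>\<omega>. splice k (future \<omega>) (past_copy k (copies \<omega>))) =
  distr M Seq (\<lambda>\<omega>. splice k (future \<omega>) (past \<omega>))"
proof -
  have 1: "(\<lambda>e i. e (int (Suc i))) \<in> Dbl \<rightarrow>\<^sub>M Seq"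
    by (intro measurable_into_PiM_UNIV) (rule measurable_component_singleton, simp)
  have c: "indep_pair M Seq future Seq (\<lambda>\<omega>. past_copy k (copies \<omega>))"
    using indep_pair_compose[OF indep_eps_copies 1 past_copy_measurable] by (simp add: future_def[abs_def])
  have "distr M (Seq \<Otimes>\<^sub>M Seq) (\<lambda>\<omega>. (future \<omega>, past_copy k (copies \<omega>))) =
      distr M (Seq \<Otimes>\<^sub>M Seq) (\<lambda>\<omega>. (future \<omega>, past \<omega>))"
    using c indep_past_future(2) law_past_copy[of k] unfolding indep_pair_def by metis
  then have "distr (distr M (Seq \<Otimes>\<^sub>M Seq) (\<lambda>\<omega>. (future \<omega>, past_copy k (copies \<omega>)))) Seq (\<lambda>q. splice k (fst q) (snd q)) =
      distr (distr M (Seq \<Otimes>\<^sub>M Seq) (\<lambda>\<omega>. (future \<omega>, past \<omega>))) Seq (\<lambda>q. splice k (fst q) (snd q))"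
    by simp
  then show ?thesis
    by (subst (asm) (1 2) distr_distr) (simp_all add: comp_def)
qed

text \<open>Both sides are the infinite product of the common law of the innovations.\<close>

lemma law_shift: "distr M Dbl (\<lambda>\<omega> k. \<epsilon> (k + n) \<omega>) = distr M Dbl (\<lambda>\<omega> k. \<epsilon> k \<omega>)"
proof -
  have ind: "indep_vars (\<lambda>_. S) \<epsilon> UNIV" and id: "\<And>k. distr M S (\<epsilon> k) = distr M S (\<epsilon> 0)"
    using iid by (auto simp: iid_seq_def)
  define P where "P = (\<lambda>k. distr M S (\<epsilon> k))"
  have eps: "distr M Dbl (\<lambda>\<omega> k. \<epsilon> k \<omega>) = PiM UNIV P"
    using ind by (subst (asm) indep_vars_iff_distr_eq_PiM) (simp_all add: P_def restrict_def)
  have sh: "(\<lambda>e k. e (k + n)) \<in> Dbl \<rightarrow>\<^sub>M Dbl"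
    by (intro measurable_into_PiM_UNIV) simp
  have "distr M Dbl (\<lambda>\<omega> k. \<epsilon> (k + n) \<omega>) = distr (distr M Dbl (\<lambda>\<omega> k. \<epsilon> k \<omega>)) Dbl (\<lambda>e k. e (k + n))"
    by (subst distr_distr[OF sh]) (simp_all add: comp_def)
  also have "\<dots> = distr (PiM UNIV P) (PiM UNIV (\<lambda>k. P (k + n))) (\<lambda>e. \<lambda>k\<in>UNIV. e (k + n))"
    unfolding eps by (intro distr_cong refl) (auto simp: P_def intro!: sets_PiM_cong)
  also have "\<dots> = PiM UNIV (\<lambda>k. P (k + n))"
    by (rule distr_PiM_reindex) (auto simp: P_def prob_space_distr)
  also have "\<dots> = PiM UNIV P"
    using id unfolding P_def by metis
  finally show ?thesis unfolding eps .
qed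

end

lemma (in coupled_innovations) law_window:
  "distr M Seq (\<lambda>\<omega> a. \<epsilon> (n - int a) \<omega>) = distr M Seq past"
proof -
  have 1: "(\<lambda>e a. e (- int a)) \<in> Dbl \<rightarrow>\<^sub>M Seq" by (intro measurable_into_PiM_UNIV) simp
  have "distr (distr M Dbl (\<lambda>\<omega> k. \<epsilon> (k + n) \<omega>)) Seq (\<lambda>e a. e (- int a)) =
      distr (distr M Dbl (\<lambda>\<omega> k. \<epsilon> k \<omega>)) Seq (\<lambda>e a. e (- int a))"
    by (simp only: law_shift)
  then show ?thesis
    by (simp add: distr_distr[OF 1] comp_def past_def[abs_def])
qed

section \<open>Real scores of a shift process\<close>

locale shift_scores = coupled_innovations M S \<epsilon> \<epsilon>c
  for M :: "'w measure" and S :: "'s measure" and \<epsilon> :: "int \<Rightarrow> 'w \<Rightarrow> 's" and \<epsilon>c :: "int \<Rightarrow> int \<Rightarrow> 'w \<Rightarrow> 's" +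
  fixes g :: "'d::finite \<Rightarrow> (nat \<Rightarrow> 's) \<Rightarrow> real"
  assumes g_measurable [measurable]: "g i \<in> borel_measurable (PiM UNIV (\<lambda>_. S))"
    and g_mean_zero: "expectation (\<lambda>\<omega>. g i (past \<omega>)) = 0"
begin

definition x :: "'d \<Rightarrow> int \<Rightarrow> 'w \<Rightarrow> real" where
  "x i n \<omega> = g i (\<lambda>a. \<epsilon> (n - int a) \<omega>)"

definition x' :: "'d \<Rightarrow> nat \<Rightarrow> 'w \<Rightarrow> real" where
  "x' i k \<omega> = g i (splice k (future \<omega>) (past_copy k (copies \<omega>)))"

lemma x_measurable [measurable]: "x i n \<in> borel_measurable M"
  unfolding x_def
  by (rule measurable_compose[OF _ g_measurable]) (rule eps_path_measurable)

lemma x_0: "x i 0 \<omega> = g i (past \<omega>)"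
  by (simp add: x_def past_def)

lemma x'_function_of_future_copies:
  obtains h where "h \<in> borel_measurable (Seq \<Otimes>\<^sub>M Cop)" "\<And>\<omega>. x' i k \<omega> = h (future \<omega>, copies \<omega>)"
proof
  have "(\<lambda>q. (fst q, past_copy k (snd q))) \<in> Seq \<Otimes>\<^sub>M Cop \<rightarrow>\<^sub>M Seq \<Otimes>\<^sub>M Seq" by measurable
  from measurable_compose[OF measurable_compose[OF this splice_measurable] g_measurable]
  show "(\<lambda>q. g i (splice k (fst q) (past_copy k (snd q)))) \<in> borel_measurable (Seq \<Otimes>\<^sub>M Cop)"
    by simp
qed (simp add: x'_def)

lemma x'_measurable [measurable]: "x' i k \<in> borel_measurable M"
proof -
  obtain h where h: "h \<in> borel_measurable (Seq \<Otimes>\<^sub>M Cop)" "\<And>\<omega>. x' i k \<omega> = h (future \<omega>, copies \<omega>)"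
    by (rule x'_function_of_future_copies) blast
  have "(\<lambda>\<omega>. h (future \<omega>, copies \<omega>)) \<in> borel_measurable M"
    by (rule measurable_compose[OF _ h(1)]) simp
  then show ?thesis using h(2) by presburger
qed

text \<open>The score at time 0 has mean zero and is a function of the past, which is independent of the future and the copies.\<close>

lemma past_orthogonal:
  assumes h: "h \<in> borel_measurable (Seq \<Otimes>\<^sub>M Cop)"
    and i: "integrable M (x i 0)" "integrable M (\<lambda>\<omega>. h (future \<omega>, copies \<omega>))"
  shows "expectation (\<lambda>\<omega>. x i 0 \<omega> * h (future \<omega>, copies \<omega>)) = 0"
proof -
  have "indep_var borel (x i 0) borel (\<lambda>\<omega>. h (future \<omega>, copies \<omega>))"
    using indep_pair_compose[OF past_indep_future_copies g_measurable h]
    by (simp add: indep_var_iff_indep_pair x_0[abs_def])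
  from indep_var_lebesgue_integral[OF this i] show ?thesis
    using g_mean_zero by (simp add: x_0)
qed

lemma expectation_shift:
  assumes F: "F \<in> borel_measurable Dbl"
  shows "expectation (\<lambda>\<omega>. F (\<lambda>k. \<epsilon> (k + n) \<omega>)) = (expectation (\<lambda>\<omega>. F (\<lambda>k. \<epsilon> k \<omega>)) :: real)"
  using integral_distr[OF eps_path_measurable[of "\<lambda>k. k + n"] F]
    integral_distr[OF eps_path_measurable[of "\<lambda>k. k"] F] law_shift[of n] by simp

lemma path_functional_measurable [measurable]:
  "(\<lambda>e. g i (\<lambda>a. e (n - int a))) \<in> borel_measurable Dbl"
  by (rule measurable_compose[OF measurable_into_PiM_UNIV g_measurable]) simp

lemma x_product_shift:
  "expectation (\<lambda>\<omega>. x i (n + m) \<omega> * x j (k + m) \<omega>) = expectation (\<lambda>\<omega>. x i n \<omega> * x j k \<omega>)"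
proof -
  have "(\<lambda>e. g i (\<lambda>a. e (n - int a)) * g j (\<lambda>a. e (k - int a))) \<in> borel_measurable Dbl"
    by simp
  from expectation_shift[OF this, of m] show ?thesis
    by (simp add: x_def algebra_simps)
qed

lemma x_product4_shift:
  "expectation (\<lambda>\<omega>. (x i (n + m) \<omega> * x j (k + m) \<omega>) * (x i (n' + m) \<omega> * x j (k' + m) \<omega>)) =
   expectation (\<lambda>\<omega>. (x i n \<omega> * x j k \<omega>) * (x i n' \<omega> * x j k' \<omega>))"
proof -
  have "(\<lambda>e. (g i (\<lambda>a. e (n - int a)) * g j (\<lambda>a. e (k - int a))) *
      (g i (\<lambda>a. e (n' - int a)) * g j (\<lambda>a. e (k' - int a)))) \<in> borel_measurable Dbl"
    by simp
  from expectation_shift[OF this, of m] show ?thesis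
    by (simp add: x_def algebra_simps)
qed

text \<open>The score at time 0 is orthogonal to the coupled score \<open>x' j k\<close>, so \<open>x j k\<close> may be replaced by its coupling error, and the
Cauchy-Schwarz inequality applies.\<close>

lemma autocovariance_decay:
  assumes x: "\<And>i n. Lp_le M 2 (x i n) K" and x': "\<And>i k. Lp_le M 2 (x' i k) K"
    and d: "Lp_le M 2 (\<lambda>\<omega>. x j (int k) \<omega> - x' j k \<omega>) a"
  shows "\<bar>expectation (\<lambda>\<omega>. x i 0 \<omega> * x j (int k) \<omega>)\<bar> \<le> K * a"
proof -
  obtain h where h: "h \<in> borel_measurable (Seq \<Otimes>\<^sub>M Cop)" "\<And>\<omega>. x' j k \<omega> = h (future \<omega>, copies \<omega>)"
    by (rule x'_function_of_future_copies) blast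
  have "integrable M (x i 0)" "integrable M (x' j k)"
    by (rule L2_integrable[OF x] L2_integrable[OF x'])+
  then have "expectation (\<lambda>\<omega>. x i 0 \<omega> * x' j k \<omega>) = 0"
    using past_orthogonal[OF h(1), of i] by (simp add: h(2) [abs_def])
  moreover have "integrable M (\<lambda>\<omega>. x i 0 \<omega> * x' j k \<omega>)" "integrable M (\<lambda>\<omega>. x i 0 \<omega> * x j (int k) \<omega>)"
    by (rule L2_product_integrable[OF x x'] L2_product_integrable[OF x x])+
  ultimately have "expectation (\<lambda>\<omega>. x i 0 \<omega> * x j (int k) \<omega>) =
      expectation (\<lambda>\<omega>. x i 0 \<omega> * (x j (int k) \<omega> - x' j k \<omega>))"
    by (simp add: right_diff_distrib)
  then show ?thesis
    using L2_product_integrable(2)[OF x d] by simp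
qed

end

locale L4_shift_scores = shift_scores M S \<epsilon> \<epsilon>c g
  for M :: "'w measure" and S :: "'s measure" and \<epsilon> :: "int \<Rightarrow> 'w \<Rightarrow> 's" and \<epsilon>c :: "int \<Rightarrow> int \<Rightarrow> 'w \<Rightarrow> 's"
    and g :: "'d::finite \<Rightarrow> (nat \<Rightarrow> 's) \<Rightarrow> real" +
  fixes K :: real and a :: "nat \<Rightarrow> real"
  assumes x_L4: "Lp_le M 4 (x i n) K" and x'_L4: "Lp_le M 4 (x' i k) K"
    and diff_L4: "1 \<le> k \<Longrightarrow> Lp_le M 4 (\<lambda>\<omega>. x i (int k) \<omega> - x' i k \<omega>) (a k)"
    and summable_a: "summable (\<lambda>k. a (Suc k))"
begin

lemma L4_mult: "Lp_le M 4 A c \<Longrightarrow> Lp_le M 4 B d \<Longrightarrow> Lp_le M 2 (\<lambda>\<omega>. A \<omega> * B \<omega>) (c * d)"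
  using Lp_le_mult[of M 2] by simp

lemma xx_L2: "Lp_le M 2 (\<lambda>\<omega>. x i n \<omega> * x j m \<omega>) (K * K)"
  by (intro L4_mult x_L4)

lemma K_nonneg: "0 \<le> K"
  using x_L4 by (rule Lp_le_nonneg)

lemma a_nonneg: "1 \<le> k \<Longrightarrow> 0 \<le> a k"
  using diff_L4 by (rule Lp_le_nonneg)

text \<open>By stationarity these numbers are the absolute covariances of any two products of scores with lags \<open>k\<close> and \<open>l\<close> whose base times
differ by \<open>r\<close>.\<close>

definition abs_cov :: "'d \<Rightarrow> 'd \<Rightarrow> nat \<Rightarrow> nat \<Rightarrow> int \<Rightarrow> real" where
  "abs_cov i j k l r = \<bar>covariance M (\<lambda>\<omega>. x i 0 \<omega> * x j (int k) \<omega>) (\<lambda>\<omega>. x i r \<omega> * x j (r + int l) \<omega>)\<bar>"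

text \<open>This is the covariance whose sum over \<open>k\<close>, \<open>l\<close> and \<open>r\<close> is assumed to be of smaller order than \<open>N\<close>.\<close>

definition coupling_cov :: "'d \<Rightarrow> 'd \<Rightarrow> nat \<Rightarrow> nat \<Rightarrow> nat \<Rightarrow> real" where
  "coupling_cov i j k l r = \<bar>covariance M (\<lambda>\<omega>. x i 0 \<omega> * (x j (int k) \<omega> - x' j k \<omega>)) (\<lambda>\<omega>. x' i r \<omega> * x' j (r + l) \<omega>)\<bar>"

lemma abs_cov_nonneg: "0 \<le> abs_cov i j k l r" by (simp add: abs_cov_def)

lemma abs_cov_bound: "abs_cov i j k l r \<le> 2 * K ^ 4"
  using covariance_bound[OF xx_L2 xx_L2] by (simp add: abs_cov_def power4_eq_xxxx mult.assoc)

lemma covariance_shift: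
  "covariance M (\<lambda>\<omega>. x i n \<omega> * x j (n + int k) \<omega>) (\<lambda>\<omega>. x i m \<omega> * x j (m + int l) \<omega>) =
   covariance M (\<lambda>\<omega>. x i 0 \<omega> * x j (int k) \<omega>) (\<lambda>\<omega>. x i (m - n) \<omega> * x j (m - n + int l) \<omega>)"
  unfolding covariance_eq[OF xx_L2 xx_L2]
  using x_product4_shift[of i 0 n j "int k" "m - n" "m - n + int l"]
    x_product_shift[of i 0 n j "int k"] x_product_shift[of i "m - n" n j "m - n + int l"]
  by (simp add: algebra_simps)

lemma abs_cov_shift:
  "\<bar>covariance M (\<lambda>\<omega>. x i n \<omega> * x j (n + int k) \<omega>) (\<lambda>\<omega>. x i m \<omega> * x j (m + int l) \<omega>)\<bar> = abs_cov i j k l (m - n)"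
  by (simp add: abs_cov_def covariance_shift)

lemma abs_cov_swap: "abs_cov i j k l (- r) = abs_cov i j l k r"
  using abs_cov_shift[of i r j k 0 l] abs_cov_shift[of i 0 j l r k] by (simp add: covariance_commute)

text \<open>With \<open>s = r + l\<close>, replacing the scores at times \<open>r\<close> and \<open>s\<close> one after the other by their coupled versions changes the covariance
by at most \<open>2 K\<^sup>3 a\<^sub>r\<close> and \<open>2 K\<^sup>3 a\<^sub>s\<close>. In the covariance that remains, the part of \<open>x j k\<close> given by its coupled version
contributes nothing: both expectations in \<open>Cov (x\<^sub>i\<^sub>0 x'\<^sub>j\<^sub>k, x'\<^sub>i\<^sub>r x'\<^sub>j\<^sub>s)\<close> contain the factor \<open>x\<^sub>i\<^sub>0\<close>, which is orthogonal to
functions of the future and the copies.\<close>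

lemma abs_cov_decay:
  assumes r: "1 \<le> r"
  shows "abs_cov i j k l (int r) \<le> coupling_cov i j k l r + 2 * K ^ 3 * (a r + a (r + l))"
proof -
  define s where "s = r + l"
  have s: "1 \<le> s" using r by (simp add: s_def)
  let ?x0 = "x i 0" and ?y = "x j (int k)" and ?y' = "x' j k"
  let ?xr = "x i (int r)" and ?xr' = "x' i r" and ?ys = "x j (int s)" and ?ys' = "x' j s"
  note L4 = x_L4 x'_L4 diff_L4[OF r] diff_L4[OF s]
  \<comment> \<open>First \<open>?xr\<close> and then \<open>?ys\<close> is replaced by its coupled version.\<close>
  have split: "covariance M (\<lambda>\<omega>. ?x0 \<omega> * ?y \<omega>) (\<lambda>\<omega>. ?xr \<omega> * ?ys \<omega>) =
      covariance M (\<lambda>\<omega>. ?x0 \<omega> * ?y \<omega>) (\<lambda>\<omega>. (?xr \<omega> - ?xr' \<omega>) * ?ys \<omega>) +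
      (covariance M (\<lambda>\<omega>. ?x0 \<omega> * ?y \<omega>) (\<lambda>\<omega>. ?xr' \<omega> * (?ys \<omega> - ?ys' \<omega>)) +
       covariance M (\<lambda>\<omega>. ?x0 \<omega> * ?y \<omega>) (\<lambda>\<omega>. ?xr' \<omega> * ?ys' \<omega>))"
  proof -
    have "covariance M (\<lambda>\<omega>. ?x0 \<omega> * ?y \<omega>) (\<lambda>\<omega>. ?xr \<omega> * ?ys \<omega>) =
      covariance M (\<lambda>\<omega>. ?x0 \<omega> * ?y \<omega>) (\<lambda>\<omega>. (?xr \<omega> - ?xr' \<omega>) * ?ys \<omega> + ?xr' \<omega> * ?ys \<omega>)"
      by (simp add: algebra_simps)
    also have "\<dots> = covariance M (\<lambda>\<omega>. ?x0 \<omega> * ?y \<omega>) (\<lambda>\<omega>. (?xr \<omega> - ?xr' \<omega>) * ?ys \<omega>) +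
      covariance M (\<lambda>\<omega>. ?x0 \<omega> * ?y \<omega>) (\<lambda>\<omega>. ?xr' \<omega> * ?ys \<omega>)"
      by (rule covariance_add_right[OF xx_L2 L4_mult[OF diff_L4[OF r] x_L4] L4_mult[OF x'_L4 x_L4]])
    also have "covariance M (\<lambda>\<omega>. ?x0 \<omega> * ?y \<omega>) (\<lambda>\<omega>. ?xr' \<omega> * ?ys \<omega>) =
      covariance M (\<lambda>\<omega>. ?x0 \<omega> * ?y \<omega>) (\<lambda>\<omega>. ?xr' \<omega> * (?ys \<omega> - ?ys' \<omega>) + ?xr' \<omega> * ?ys' \<omega>)"
      by (simp add: algebra_simps)
    also have "\<dots> = covariance M (\<lambda>\<omega>. ?x0 \<omega> * ?y \<omega>) (\<lambda>\<omega>. ?xr' \<omega> * (?ys \<omega> - ?ys' \<omega>)) +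
       covariance M (\<lambda>\<omega>. ?x0 \<omega> * ?y \<omega>) (\<lambda>\<omega>. ?xr' \<omega> * ?ys' \<omega>)"
      by (rule covariance_add_right[OF xx_L2 L4_mult[OF x'_L4 diff_L4[OF s]] L4_mult[OF x'_L4 x'_L4]])
    finally show ?thesis .
  qed
  have "\<bar>covariance M (\<lambda>\<omega>. ?x0 \<omega> * ?y \<omega>) (\<lambda>\<omega>. (?xr \<omega> - ?xr' \<omega>) * ?ys \<omega>)\<bar> \<le> 2 * ((K * K) * (a r * K))"
    by (intro covariance_bound L4_mult L4)
  moreover have "\<bar>covariance M (\<lambda>\<omega>. ?x0 \<omega> * ?y \<omega>) (\<lambda>\<omega>. ?xr' \<omega> * (?ys \<omega> - ?ys' \<omega>))\<bar> \<le> 2 * ((K * K) * (K * a s))"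
    by (intro covariance_bound L4_mult L4)
  moreover have "covariance M (\<lambda>\<omega>. ?x0 \<omega> * ?y \<omega>) (\<lambda>\<omega>. ?xr' \<omega> * ?ys' \<omega>) =
      covariance M (\<lambda>\<omega>. ?x0 \<omega> * (?y \<omega> - ?y' \<omega>)) (\<lambda>\<omega>. ?xr' \<omega> * ?ys' \<omega>)"
  proof -
    obtain h1 where h1: "h1 \<in> borel_measurable (Seq \<Otimes>\<^sub>M Cop)" "\<And>\<omega>. x' j k \<omega> = h1 (future \<omega>, copies \<omega>)"
      by (rule x'_function_of_future_copies) blast
    obtain h2 where h2: "h2 \<in> borel_measurable (Seq \<Otimes>\<^sub>M Cop)" "\<And>\<omega>. x' i r \<omega> = h2 (future \<omega>, copies \<omega>)"
      by (rule x'_function_of_future_copies) blast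
    obtain h3 where h3: "h3 \<in> borel_measurable (Seq \<Otimes>\<^sub>M Cop)" "\<And>\<omega>. x' j s \<omega> = h3 (future \<omega>, copies \<omega>)"
      by (rule x'_function_of_future_copies) blast
    have x_2: "Lp_le M 2 (x i n) K" and x'_2: "Lp_le M 2 (x' i n') K" for i n n'
      using Lp_le_half[of 2] x_L4 x'_L4 by simp_all
    have L1: "integrable M ?x0" "integrable M ?y'" "integrable M (\<lambda>\<omega>. ?y' \<omega> * (?xr' \<omega> * ?ys' \<omega>))"
      by (rule L2_integrable[OF x_2] L2_integrable[OF x'_2] L2_product_integrable[OF x'_2 L4_mult[OF x'_L4 x'_L4]])+
    have "expectation (\<lambda>\<omega>. ?x0 \<omega> * h1 (future \<omega>, copies \<omega>)) = 0"
      using L1 by (intro past_orthogonal h1) (simp_all add: h1(2)[symmetric])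
    then have e1: "expectation (\<lambda>\<omega>. ?x0 \<omega> * ?y' \<omega>) = 0" by (simp add: h1(2))
    have "expectation (\<lambda>\<omega>. ?x0 \<omega> * (\<lambda>q. h1 q * (h2 q * h3 q)) (future \<omega>, copies \<omega>)) = 0"
      using L1 h1(1) h2(1) h3(1) by (intro past_orthogonal) (simp_all add: h1(2) h2(2) h3(2))
    then have e3: "expectation (\<lambda>\<omega>. (?x0 \<omega> * ?y' \<omega>) * (?xr' \<omega> * ?ys' \<omega>)) = 0"
      by (simp add: h1(2) h2(2) h3(2) mult.assoc)
    have z: "covariance M (\<lambda>\<omega>. ?x0 \<omega> * ?y' \<omega>) (\<lambda>\<omega>. ?xr' \<omega> * ?ys' \<omega>) = 0"
      using e1 e3 covariance_eq[OF L4_mult[OF x_L4 x'_L4] L4_mult[OF x'_L4 x'_L4]] by simp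
    let ?B = "\<lambda>\<omega>. ?xr' \<omega> * ?ys' \<omega>"
    have diff: "Lp_le M 2 (\<lambda>\<omega>. ?x0 \<omega> * (?y \<omega> - ?y' \<omega>)) (K * (4 * K))"
      by (rule L4_mult[OF x_L4 Lp_le_diff[OF _ x_L4 x'_L4]]) simp
    have "covariance M ?B (\<lambda>\<omega>. ?x0 \<omega> * ?y \<omega>) =
      covariance M ?B (\<lambda>\<omega>. ?x0 \<omega> * (?y \<omega> - ?y' \<omega>) + ?x0 \<omega> * ?y' \<omega>)"
      by (simp add: algebra_simps)
    also have "\<dots> = covariance M ?B (\<lambda>\<omega>. ?x0 \<omega> * (?y \<omega> - ?y' \<omega>)) + covariance M ?B (\<lambda>\<omega>. ?x0 \<omega> * ?y' \<omega>)"
      by (rule covariance_add_right[OF L4_mult[OF x'_L4 x'_L4] diff L4_mult[OF x_L4 x'_L4]])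
    finally show ?thesis using z by (simp add: covariance_commute)
  qed
  ultimately have "\<bar>covariance M (\<lambda>\<omega>. ?x0 \<omega> * ?y \<omega>) (\<lambda>\<omega>. ?xr \<omega> * ?ys \<omega>)\<bar> \<le>
      2 * ((K * K) * (a r * K)) + 2 * ((K * K) * (K * a s)) + coupling_cov i j k l r"
    unfolding split by (simp add: coupling_cov_def s_def)
  also have "2 * ((K * K) * (a r * K)) + 2 * ((K * K) * (K * a s)) = 2 * K ^ 3 * (a r + a s)"
    by (simp add: algebra_simps power3_eq_cube)
  finally show ?thesis by (simp add: abs_cov_def s_def)
qed

end

section \<open>Second moments of weighted sums of products\<close>

text \<open>The summand depends on the position of \<open>n\<close> and \<open>m\<close> only through \<open>m - n\<close>, and each difference occurs at most \<open>N\<close> times. The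
symmetry of \<open>h\<close> folds the negative differences onto the positive ones after exchanging \<open>k\<close> and \<open>l\<close>.\<close>

lemma sum_abs_differences_le:
  fixes h :: "nat \<Rightarrow> nat \<Rightarrow> int \<Rightarrow> real"
  assumes nonneg: "\<And>k l r. 0 \<le> h k l r" and swap: "\<And>k l r. h k l (- r) = h l k r"
  shows "(\<Sum>k\<in>Q. \<Sum>l\<in>Q. \<Sum>n\<in>{1..int N}. \<Sum>m\<in>{1..int N}. h k l (m - n)) \<le>
    real N * ((\<Sum>k\<in>Q. \<Sum>l\<in>Q. h k l 0) + 2 * (\<Sum>k\<in>Q. \<Sum>l\<in>Q. \<Sum>r=1..N - 1. h k l (int r)))"
proof -
  define T where "T = {1..N - 1}"
  have row: "(\<Sum>m\<in>{1..int N}. h k l (m - n)) \<le> h k l 0 + (\<Sum>r\<in>T. h k l (int r)) + (\<Sum>r\<in>T. h l k (int r))"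
    if n: "n \<in> {1..int N}" for k l n
  proof -
    let ?U = "{0} \<union> int ` T \<union> (\<lambda>r. - int r) ` T"
    have "(\<Sum>m\<in>{1..int N}. h k l (m - n)) = (\<Sum>r\<in>(\<lambda>m. m - n) ` {1..int N}. h k l r)"
      by (subst sum.reindex) (auto simp: inj_on_def)
    also have "\<dots> \<le> (\<Sum>r\<in>?U. h k l r)"
    proof (rule sum_mono2)
      show "(\<lambda>m. m - n) ` {1..int N} \<subseteq> ?U"
      proof safe
        fix m assume m: "m \<in> {1..int N}" "m - n \<notin> (\<lambda>r. - int r) ` T" "m - n \<notin> int ` T"
        have "nat \<bar>m - n\<bar> \<in> T" if "m \<noteq> n" using that m(1) n by (auto simp: T_def)
        then show "m - n = 0"
          using m(2,3) by (cases "m < n"; cases "m = n") (force simp: image_iff)+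
      qed
    qed (auto simp: T_def nonneg)
    also have "\<dots> = (\<Sum>r\<in>{0} \<union> int ` T. h k l r) + (\<Sum>r\<in>(\<lambda>r. - int r) ` T. h k l r)"
      by (rule sum.union_disjoint) (auto simp: T_def)
    also have "(\<Sum>r\<in>{0} \<union> int ` T. h k l r) = h k l 0 + (\<Sum>r\<in>int ` T. h k l r)"
      by (subst sum.union_disjoint) (auto simp: T_def)
    also have "(\<Sum>r\<in>int ` T. h k l r) = (\<Sum>r\<in>T. h k l (int r))"
      by (subst sum.reindex) (auto simp: inj_on_def)
    also have "(\<Sum>r\<in>(\<lambda>r. - int r) ` T. h k l r) = (\<Sum>r\<in>T. h l k (int r))"
      by (subst sum.reindex) (auto simp: inj_on_def swap)
    finally show ?thesis .
  qed
  have "(\<Sum>k\<in>Q. \<Sum>l\<in>Q. \<Sum>n\<in>{1..int N}. \<Sum>m\<in>{1..int N}. h k l (m - n)) \<le>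
      (\<Sum>k\<in>Q. \<Sum>l\<in>Q. \<Sum>n\<in>{1..int N}. h k l 0 + (\<Sum>r\<in>T. h k l (int r)) + (\<Sum>r\<in>T. h l k (int r)))"
    by (intro sum_mono row)
  also have "\<dots> = real N * ((\<Sum>k\<in>Q. \<Sum>l\<in>Q. h k l 0) + (\<Sum>k\<in>Q. \<Sum>l\<in>Q. \<Sum>r\<in>T. h k l (int r)) +
      (\<Sum>k\<in>Q. \<Sum>l\<in>Q. \<Sum>r\<in>T. h l k (int r)))"
    by (simp add: sum.distrib sum_distrib_left distrib_left)
  also have "(\<Sum>k\<in>Q. \<Sum>l\<in>Q. \<Sum>r\<in>T. h l k (int r)) = (\<Sum>k\<in>Q. \<Sum>l\<in>Q. \<Sum>r\<in>T. h k l (int r))"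
    by (rule sum.swap)
  finally show ?thesis by (simp add: T_def algebra_simps)
qed

context L4_shift_scores begin

definition centred :: "'d \<Rightarrow> 'd \<Rightarrow> nat \<Rightarrow> int \<Rightarrow> 'w \<Rightarrow> real" where
  "centred i j k n \<omega> = x i n \<omega> * x j (n + int k) \<omega> - expectation (\<lambda>\<omega>. x i 0 \<omega> * x j (int k) \<omega>)"

text \<open>Up to the factor \<open>1/N\<close>, one of the two parts into which an entry of the centred kernel estimator splits: \<open>u\<close> stands for the weights, and \<open>I k\<close> for the times at which
products of lag \<open>k\<close> are observed.\<close>

definition weighted_sum :: "'d \<Rightarrow> 'd \<Rightarrow> (nat \<Rightarrow> real) \<Rightarrow> nat \<Rightarrow> (nat \<Rightarrow> int set) \<Rightarrow> 'w \<Rightarrow> real" where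
  "weighted_sum i j u q I \<omega> = (\<Sum>k=0..q. u k * (\<Sum>n\<in>I k. centred i j k n \<omega>))"

lemma xx_expectation: "expectation (\<lambda>\<omega>. x i n \<omega> * x j (n + int k) \<omega>) = expectation (\<lambda>\<omega>. x i 0 \<omega> * x j (int k) \<omega>)"
  using x_product_shift[of i 0 n j "int k"] by (simp add: add.commute)

lemma centred_product_integrable: "integrable M (\<lambda>\<omega>. centred i j k n \<omega> * centred i j l m \<omega>)"
  and centred_product_expectation: "\<bar>expectation (\<lambda>\<omega>. centred i j k n \<omega> * centred i j l m \<omega>)\<bar> = abs_cov i j k l (m - n)"
proof -
  let ?A = "\<lambda>\<omega>. x i n \<omega> * x j (n + int k) \<omega>" and ?B = "\<lambda>\<omega>. x i m \<omega> * x j (m + int l) \<omega>"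
  have "integrable M (\<lambda>\<omega>. ?A \<omega> * ?B \<omega> - expectation ?B * ?A \<omega> - expectation ?A * ?B \<omega> + expectation ?A * expectation ?B)"
    using L2_product_integrable(1)[OF xx_L2 xx_L2, of i n j "n + int k" i m j "m + int l"]
      L2_integrable[OF xx_L2, of i n j "n + int k"] L2_integrable[OF xx_L2, of i m j "m + int l"] by simp
  then show "integrable M (\<lambda>\<omega>. centred i j k n \<omega> * centred i j l m \<omega>)"
    by (simp add: centred_def xx_expectation algebra_simps)
  show "\<bar>expectation (\<lambda>\<omega>. centred i j k n \<omega> * centred i j l m \<omega>)\<bar> = abs_cov i j k l (m - n)"
    unfolding abs_cov_shift[symmetric] covariance_def centred_def xx_expectation ..
qed

text \<open>Expanding the square gives covariances of products, which by stationarity are the numbers \<open>abs_cov\<close>. These are nonnegative,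
so the sets of times may be enlarged to \<open>{1..N}\<close>.\<close>

lemma weighted_sum_second_moment:
  assumes u: "\<And>k. \<bar>u k\<bar> \<le> b" and I: "\<And>k. I k \<subseteq> {1..int N}"
  shows "integrable M (\<lambda>\<omega>. (weighted_sum i j u q I \<omega>)\<^sup>2)"
    and "expectation (\<lambda>\<omega>. (weighted_sum i j u q I \<omega>)\<^sup>2) \<le> b\<^sup>2 * (real N *
      ((\<Sum>k=0..q. \<Sum>l=0..q. abs_cov i j k l 0) + 2 * (\<Sum>k=0..q. \<Sum>l=0..q. \<Sum>r=1..N - 1. abs_cov i j k l (int r))))"
proof -
  have b: "0 \<le> b" using u[of 0] by linarith
  have sq: "(weighted_sum i j u q I \<omega>)\<^sup>2 = (\<Sum>k=0..q. \<Sum>l=0..q. \<Sum>n\<in>I k. \<Sum>m\<in>I l. (u k * u l) * (centred i j k n \<omega> * centred i j l m \<omega>))" for \<omega>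
  proof -
    have product: "(u k * (\<Sum>n\<in>I k. centred i j k n \<omega>)) * (u l * (\<Sum>m\<in>I l. centred i j l m \<omega>)) =
        (\<Sum>n\<in>I k. \<Sum>m\<in>I l. (u k * u l) * (centred i j k n \<omega> * centred i j l m \<omega>))" for k l
    proof -
      have regroup: "(u k * s) * (u l * t) = (u k * u l) * (s * t)" for s t by simp
      show ?thesis unfolding regroup sum_product by (simp only: sum_distrib_left)
    qed
    show ?thesis
      unfolding weighted_sum_def power2_eq_square by (subst sum_product) (intro sum.cong refl product)
  qed
  show "integrable M (\<lambda>\<omega>. (weighted_sum i j u q I \<omega>)\<^sup>2)"
    unfolding sq by (intro Bochner_Integration.integrable_sum integrable_mult_right centred_product_integrable)
  have "expectation (\<lambda>\<omega>. (weighted_sum i j u q I \<omega>)\<^sup>2) =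
      (\<Sum>k=0..q. \<Sum>l=0..q. \<Sum>n\<in>I k. \<Sum>m\<in>I l. (u k * u l) * expectation (\<lambda>\<omega>. centred i j k n \<omega> * centred i j l m \<omega>))"
    unfolding sq
    by (simp add: Bochner_Integration.integral_sum Bochner_Integration.integrable_sum centred_product_integrable)
  also have "\<dots> \<le> (\<Sum>k=0..q. \<Sum>l=0..q. \<Sum>n\<in>I k. \<Sum>m\<in>I l. b\<^sup>2 * abs_cov i j k l (m - n))"
  proof (intro sum_mono)
    fix k l n m
    have "(u k * u l) * expectation (\<lambda>\<omega>. centred i j k n \<omega> * centred i j l m \<omega>) \<le> (\<bar>u k\<bar> * \<bar>u l\<bar>) * abs_cov i j k l (m - n)"
      unfolding centred_product_expectation[symmetric] abs_mult[symmetric] by (rule abs_ge_self)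
    also have "\<dots> \<le> b\<^sup>2 * abs_cov i j k l (m - n)"
      unfolding power2_eq_square using u b by (intro mult_right_mono mult_mono abs_cov_nonneg) auto
    finally show "(u k * u l) * expectation (\<lambda>\<omega>. centred i j k n \<omega> * centred i j l m \<omega>) \<le> b\<^sup>2 * abs_cov i j k l (m - n)" .
  qed
  also have "\<dots> \<le> (\<Sum>k=0..q. \<Sum>l=0..q. \<Sum>n\<in>{1..int N}. \<Sum>m\<in>{1..int N}. b\<^sup>2 * abs_cov i j k l (m - n))"
  proof (intro sum_mono)
    fix k l
    have "(\<Sum>n\<in>I k. \<Sum>m\<in>I l. b\<^sup>2 * abs_cov i j k l (m - n)) \<le> (\<Sum>n\<in>I k. \<Sum>m\<in>{1..int N}. b\<^sup>2 * abs_cov i j k l (m - n))"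
      by (intro sum_mono sum_mono2 I) (auto simp: abs_cov_nonneg)
    also have "\<dots> \<le> (\<Sum>n\<in>{1..int N}. \<Sum>m\<in>{1..int N}. b\<^sup>2 * abs_cov i j k l (m - n))"
      by (intro sum_mono2 I) (auto simp: abs_cov_nonneg intro!: sum_nonneg)
    finally show "(\<Sum>n\<in>I k. \<Sum>m\<in>I l. b\<^sup>2 * abs_cov i j k l (m - n)) \<le> \<dots>" .
  qed
  also have "\<dots> = b\<^sup>2 * (\<Sum>k=0..q. \<Sum>l=0..q. \<Sum>n\<in>{1..int N}. \<Sum>m\<in>{1..int N}. abs_cov i j k l (m - n))"
    by (simp add: sum_distrib_left)
  also have "\<dots> \<le> b\<^sup>2 * (real N *
      ((\<Sum>k=0..q. \<Sum>l=0..q. abs_cov i j k l 0) + 2 * (\<Sum>k=0..q. \<Sum>l=0..q. \<Sum>r=1..N - 1. abs_cov i j k l (int r))))"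
    by (intro mult_left_mono sum_abs_differences_le abs_cov_nonneg abs_cov_swap) simp
  finally show "expectation (\<lambda>\<omega>. (weighted_sum i j u q I \<omega>)\<^sup>2) \<le> \<dots>" .
qed

lemma sum_abs_cov_le:
  "(\<Sum>r=1..N - 1. abs_cov i j k l (int r)) \<le> (\<Sum>r=1..N - 1. coupling_cov i j k l r) + 4 * K ^ 3 * (\<Sum>m. a (Suc m))"
proof -
  define s where "s = (\<Sum>m. a (Suc m))"
  have le: "(\<Sum>r=1..N - 1. a (r + l)) \<le> s" for l
  proof -
    have "(\<Sum>r=1..N - 1. a (r + l)) = (\<Sum>m\<in>(\<lambda>r. r + l - 1) ` {1..N - 1}. a (Suc m))"
      by (subst sum.reindex) (auto simp: inj_on_def)
    also have "\<dots> \<le> s"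
      unfolding s_def by (rule sum_le_suminf[OF summable_a]) (auto simp: a_nonneg)
    finally show ?thesis .
  qed
  have "(\<Sum>r=1..N - 1. abs_cov i j k l (int r)) \<le> (\<Sum>r=1..N - 1. coupling_cov i j k l r + 2 * K ^ 3 * (a r + a (r + l)))"
    by (intro sum_mono abs_cov_decay) simp
  also have "\<dots> = (\<Sum>r=1..N - 1. coupling_cov i j k l r) + 2 * K ^ 3 * ((\<Sum>r=1..N - 1. a (r + 0)) + (\<Sum>r=1..N - 1. a (r + l)))"
    by (simp add: sum.distrib sum_distrib_left distrib_left)
  also have "\<dots> \<le> (\<Sum>r=1..N - 1. coupling_cov i j k l r) + 2 * K ^ 3 * (s + s)"
    using K_nonneg by (intro add_left_mono mult_left_mono add_mono le) simp
  finally show ?thesis by (simp add: s_def)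
qed

text \<open>There are \<open>(q + 1)\<^sup>2\<close> pairs of lags. The term with \<open>r = 0\<close> and the sum of the coupling errors over \<open>r\<close> are bounded by
constants for each pair; after division by \<open>N\<close> they contribute a term of order \<open>q\<^sup>2/N\<close>.\<close>

lemma weighted_sum_second_moment_tendsto:
  assumes q: "(\<lambda>N. (real (q N))\<^sup>2 / real N) \<longlonglongrightarrow> 0"
    and R: "(\<lambda>N. (1 / real N) * (\<Sum>k=0..q N. \<Sum>l=0..q N. \<Sum>r=1..N - 1. coupling_cov i j k l r)) \<longlonglongrightarrow> 0"
    and u: "\<And>N k. \<bar>u N k\<bar> \<le> b" and I: "\<And>N k. I N k \<subseteq> {1..int N}"
  shows "(\<lambda>N. expectation (\<lambda>\<omega>. (weighted_sum i j (u N) (q N) (I N) \<omega> / real N)\<^sup>2)) \<longlonglongrightarrow> 0"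
proof -
  define s where "s = (\<Sum>m. a (Suc m))"
  define B where "B = (\<lambda>N. b\<^sup>2 * ((2 * K ^ 4 + 8 * K ^ 3 * s) * (2 * ((real (q N))\<^sup>2 / real N) + 2 * (1 / real N)) +
     2 * ((1 / real N) * (\<Sum>k=0..q N. \<Sum>l=0..q N. \<Sum>r=1..N - 1. coupling_cov i j k l r))))"
  have s: "0 \<le> s" unfolding s_def by (intro suminf_nonneg summable_a a_nonneg) simp
  have bound: "expectation (\<lambda>\<omega>. (weighted_sum i j (u N) (q N) (I N) \<omega> / real N)\<^sup>2) \<le> B N" if N: "N \<ge> 1" for N
  proof -
    let ?R = "\<Sum>k=0..q N. \<Sum>l=0..q N. \<Sum>r=1..N - 1. coupling_cov i j k l r"
    let ?c = "(real (q N) + 1)\<^sup>2"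
    have 1: "(\<Sum>k=0..q N. \<Sum>l=0..q N. abs_cov i j k l 0) \<le> ?c * (2 * K ^ 4)"
    proof -
      have "(\<Sum>k=0..q N. \<Sum>l=0..q N. abs_cov i j k l 0) \<le> (\<Sum>k=0..q N. \<Sum>l=0..q N. 2 * K ^ 4)"
        by (intro sum_mono abs_cov_bound)
      then show ?thesis by (simp add: power2_eq_square algebra_simps)
    qed
    have 2: "(\<Sum>k=0..q N. \<Sum>l=0..q N. \<Sum>r=1..N - 1. abs_cov i j k l (int r)) \<le> ?R + ?c * (4 * K ^ 3 * s)"
    proof -
      have "(\<Sum>k=0..q N. \<Sum>l=0..q N. \<Sum>r=1..N - 1. abs_cov i j k l (int r)) \<le>
          (\<Sum>k=0..q N. \<Sum>l=0..q N. (\<Sum>r=1..N - 1. coupling_cov i j k l r) + 4 * K ^ 3 * s)"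
        unfolding s_def by (intro sum_mono sum_abs_cov_le)
      then show ?thesis by (simp add: sum.distrib power2_eq_square algebra_simps)
    qed
    have c: "?c \<le> 2 * (real (q N))\<^sup>2 + 2"
      using sum_squares_bound[of "real (q N)" 1] by (simp add: power2_sum)
    have "expectation (\<lambda>\<omega>. (weighted_sum i j (u N) (q N) (I N) \<omega> / real N)\<^sup>2) =
        expectation (\<lambda>\<omega>. (weighted_sum i j (u N) (q N) (I N) \<omega>)\<^sup>2) / (real N)\<^sup>2"
      by (simp add: power_divide)
    also have "\<dots> \<le> (b\<^sup>2 * (real N * (?c * (2 * K ^ 4) + 2 * (?R + ?c * (4 * K ^ 3 * s))))) / (real N)\<^sup>2"
    proof (intro divide_right_mono order_trans[OF weighted_sum_second_moment(2)[OF u I]])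
      show "b\<^sup>2 * (real N * ((\<Sum>k=0..q N. \<Sum>l=0..q N. abs_cov i j k l 0) + 2 * (\<Sum>k=0..q N. \<Sum>l=0..q N. \<Sum>r=1..N - 1. abs_cov i j k l (int r))))
        \<le> b\<^sup>2 * (real N * (?c * (2 * K ^ 4) + 2 * (?R + ?c * (4 * K ^ 3 * s))))"
        using 1 2 by (intro mult_left_mono add_mono) auto
    qed simp
    also have "\<dots> = b\<^sup>2 * ((2 * K ^ 4 + 8 * K ^ 3 * s) * (?c / real N) + 2 * ((1 / real N) * ?R))"
      using N by (simp add: field_simps power2_eq_square)
    also have "\<dots> \<le> b\<^sup>2 * ((2 * K ^ 4 + 8 * K ^ 3 * s) * ((2 * (real (q N))\<^sup>2 + 2) / real N) + 2 * ((1 / real N) * ?R))"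
      using K_nonneg s c by (intro mult_left_mono add_right_mono divide_right_mono) auto
    also have "\<dots> = B N" by (simp add: B_def add_divide_distrib)
    finally show ?thesis .
  qed
  have "(\<lambda>N. 1 / real N) \<longlonglongrightarrow> 0" by (rule lim_1_over_n)
  then have "B \<longlonglongrightarrow> b\<^sup>2 * ((2 * K ^ 4 + 8 * K ^ 3 * s) * (2 * 0 + 2 * 0) + 2 * 0)"
    unfolding B_def by (intro tendsto_intros q R)
  then have B: "B \<longlonglongrightarrow> 0" by simp
  show ?thesis
    by (rule tendsto_sandwich[OF _ _ tendsto_const B])
      (auto intro!: always_eventually eventually_sequentiallyI[of 1] bound)
qed

end

section \<open>Summation over lags and convergence in probability\<close>

text \<open>Dominated convergence for the counting measure, with dominating function \<open>b \<parallel>\<Gamma> r\<parallel>\<close>.\<close>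

lemma truncated_weighted_sum_tendsto_infsum:
  fixes \<Gamma> :: "int \<Rightarrow> 'b :: {banach, second_countable_topology}"
  assumes \<Gamma>: "(\<lambda>r. norm (\<Gamma> r)) summable_on UNIV"
    and q: "filterlim q at_top sequentially"
    and c: "\<And>r. (\<lambda>N. c N r) \<longlonglongrightarrow> 1" and b: "\<And>N r. \<bar>c N r\<bar> \<le> b"
  shows "(\<lambda>N. \<Sum>r\<in>{- int (q N)..int (q N)}. c N r *\<^sub>R \<Gamma> r) \<longlonglongrightarrow> (\<Sum>\<^sub>\<infinity>r. \<Gamma> r)"
proof -
  define s where "s = (\<lambda>N r. if r \<in> {- int (q N)..int (q N)} then c N r *\<^sub>R \<Gamma> r else 0)"
  have b0: "0 \<le> b" using b[of 0 0] by linarith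
  have abs: "Infinite_Set_Sum.abs_summable_on \<Gamma> UNIV"
    using \<Gamma> by (simp add: abs_summable_equivalent)
  then have int: "integrable (count_space UNIV) \<Gamma>"
    by (simp add: Infinite_Set_Sum.abs_summable_on_def)
  have "(\<lambda>N. \<integral>r. s N r \<partial>count_space UNIV) \<longlonglongrightarrow> (\<integral>r. \<Gamma> r \<partial>count_space UNIV)"
  proof (rule integral_dominated_convergence[where w = "\<lambda>r. b * norm (\<Gamma> r)"])
    show "AE r in count_space UNIV. (\<lambda>N. s N r) \<longlonglongrightarrow> \<Gamma> r"
    proof (intro AE_I2)
      fix r
      have "\<forall>\<^sub>F N in sequentially. nat \<bar>r\<bar> \<le> q N"
        using q by (simp add: filterlim_at_top)
      then have "\<forall>\<^sub>F N in sequentially. c N r *\<^sub>R \<Gamma> r = s N r"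
        by eventually_elim (auto simp: s_def)
      moreover have "(\<lambda>N. c N r *\<^sub>R \<Gamma> r) \<longlonglongrightarrow> 1 *\<^sub>R \<Gamma> r"
        by (intro tendsto_intros c)
      ultimately show "(\<lambda>N. s N r) \<longlonglongrightarrow> \<Gamma> r"
        by (simp add: Lim_transform_eventually)
    qed
    fix N
    show "AE r in count_space UNIV. norm (s N r) \<le> b * norm (\<Gamma> r)"
      using b b0 by (intro AE_I2) (auto simp: s_def intro!: mult_right_mono)
  qed (use int in auto)
  also have "(\<integral>r. \<Gamma> r \<partial>count_space UNIV) = (\<Sum>\<^sub>\<infinity>r. \<Gamma> r)"
    using infsetsum_infsum[OF abs] by (simp add: infsetsum_def)
  also have "(\<lambda>N. \<integral>r. s N r \<partial>count_space UNIV) = (\<lambda>N. \<Sum>r\<in>{- int (q N)..int (q N)}. c N r *\<^sub>R \<Gamma> r)"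
  proof
    fix N
    have "{r. s N r \<noteq> 0} \<subseteq> {- int (q N)..int (q N)}" by (auto simp: s_def split: if_splits)
    then have f: "finite {r. s N r \<noteq> 0}" and "(\<Sum>r\<in>{- int (q N)..int (q N)}. s N r) = (\<Sum>r | s N r \<noteq> 0. s N r)"
      by (auto intro: finite_subset sum.mono_neutral_right)
    then show "(\<integral>r. s N r \<partial>count_space UNIV) = (\<Sum>r\<in>{- int (q N)..int (q N)}. c N r *\<^sub>R \<Gamma> r)"
      by (subst lebesgue_integral_count_space_finite_support) (auto simp: s_def)
  qed
  finally show ?thesis .
qed

lemma summable_on_int:
  fixes h :: "int \<Rightarrow> real"
  assumes c: "summable c" and h: "\<And>k. \<bar>h (int (Suc k))\<bar> \<le> c k" "\<And>k. \<bar>h (- int (Suc k))\<bar> \<le> c k"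
  shows "h summable_on UNIV"
proof -
  have "(\<lambda>k. h (int (Suc k))) summable_on UNIV" "(\<lambda>k. h (- int (Suc k))) summable_on UNIV"
    using h by (intro norm_summable_imp_summable_on summable_comparison_test'[OF c, of 0]; simp)+
  then have "h summable_on range (\<lambda>k. int (Suc k))" "h summable_on range (\<lambda>k. - int (Suc k))"
    by (subst summable_on_reindex; simp add: inj_on_def comp_def)+
  then have "h summable_on ({0} \<union> range (\<lambda>k. int (Suc k)) \<union> range (\<lambda>k. - int (Suc k)))"
    by (intro summable_on_Un_disjoint) auto
  also have "{0} \<union> range (\<lambda>k. int (Suc k)) \<union> range (\<lambda>k. - int (Suc k)) = UNIV"
  proof (intro set_eqI iffI UNIV_I)
    fix r :: int
    have "r = 0 \<or> r = int (Suc (nat (r - 1))) \<or> r = - int (Suc (nat (- r - 1)))" by linarith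
    then show "r \<in> {0} \<union> range (\<lambda>k. int (Suc k)) \<union> range (\<lambda>k. - int (Suc k))" by blast
  qed
  finally show ?thesis .
qed

lemma summable_on_finite_sum:
  fixes h :: "'i \<Rightarrow> 'a \<Rightarrow> real"
  assumes "finite I" "\<And>i. i \<in> I \<Longrightarrow> h i summable_on A"
  shows "(\<lambda>r. \<Sum>i\<in>I. h i r) summable_on A"
  using assms by (induction I rule: finite_induct) (auto intro: summable_on_add)

lemma norm_matrix_le: "norm (A :: real ^ 'm::finite ^ 'n::finite) \<le> (\<Sum>i\<in>UNIV. \<Sum>j\<in>UNIV. \<bar>A $ i $ j\<bar>)"
proof -
  have "norm A \<le> (\<Sum>i\<in>UNIV. norm (A $ i))"
    unfolding norm_vec_def by (rule L2_set_le_sum) simp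
  also have "\<dots> \<le> (\<Sum>i\<in>UNIV. \<Sum>j\<in>UNIV. \<bar>A $ i $ j\<bar>)"
    by (intro sum_mono norm_le_l1_cart)
  finally show ?thesis .
qed

text \<open>Markov's inequality for the squared Euclidean norm of the matrix, which is the sum of the squared entries. Half of \<open>e\<close> absorbs
the distance from \<open>m N\<close> to its limit.\<close>

lemma (in prob_space) tendsto_in_probability_L2:
  fixes Z :: "nat \<Rightarrow> 'a \<Rightarrow> real ^ 'm::finite ^ 'n::finite"
  assumes m: "m \<longlonglongrightarrow> z"
    and i: "\<And>N i j. integrable M (\<lambda>\<omega>. ((Z N \<omega> - m N) $ i $ j)\<^sup>2)"
    and lim: "\<And>i j. (\<lambda>N. expectation (\<lambda>\<omega>. ((Z N \<omega> - m N) $ i $ j)\<^sup>2)) \<longlonglongrightarrow> 0"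
  shows "tendsto_in_probability M Z z"
  unfolding tendsto_in_probability_def
proof (intro allI impI)
  fix e :: real assume e: "0 < e"
  have norm_sq: "(norm A)\<^sup>2 = (\<Sum>i\<in>UNIV. \<Sum>j\<in>UNIV. (A $ i $ j)\<^sup>2)" for A :: "real ^ 'm ^ 'n"
    unfolding power2_norm_eq_inner inner_vec_def by (simp add: power2_eq_square)
  have int: "integrable M (\<lambda>\<omega>. (norm (Z N \<omega> - m N))\<^sup>2)" for N
    unfolding norm_sq by (intro Bochner_Integration.integrable_sum i)
  have ex: "expectation (\<lambda>\<omega>. (norm (Z N \<omega> - m N))\<^sup>2) =
      (\<Sum>i\<in>UNIV. \<Sum>j\<in>UNIV. expectation (\<lambda>\<omega>. ((Z N \<omega> - m N) $ i $ j)\<^sup>2))" for N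
    unfolding norm_sq by (simp add: Bochner_Integration.integral_sum Bochner_Integration.integrable_sum i del: vector_minus_component)
  have "(\<lambda>N. expectation (\<lambda>\<omega>. (norm (Z N \<omega> - m N))\<^sup>2) / (e / 2)\<^sup>2) \<longlonglongrightarrow>
      (\<Sum>i\<in>(UNIV :: 'n set). \<Sum>j\<in>(UNIV :: 'm set). 0) / (e / 2)\<^sup>2"
    unfolding ex using e by (intro tendsto_intros lim) auto
  then have lim0: "(\<lambda>N. expectation (\<lambda>\<omega>. (norm (Z N \<omega> - m N))\<^sup>2) / (e / 2)\<^sup>2) \<longlonglongrightarrow> 0" by simp
  have "\<forall>\<^sub>F N in sequentially. dist (m N) z < e / 2"
    using m e by (intro tendstoD) auto
  then have ev: "\<forall>\<^sub>F N in sequentially. measure M {\<omega> \<in> space M. dist (Z N \<omega>) z > e} \<le>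
      expectation (\<lambda>\<omega>. (norm (Z N \<omega> - m N))\<^sup>2) / (e / 2)\<^sup>2"
  proof eventually_elim
    case (elim N)
    let ?E = "{\<omega> \<in> space M. (norm (Z N \<omega> - m N))\<^sup>2 \<ge> (e / 2)\<^sup>2}"
    have [measurable]: "(\<lambda>\<omega>. (norm (Z N \<omega> - m N))\<^sup>2) \<in> borel_measurable M" using int by auto
    have "{\<omega> \<in> space M. dist (Z N \<omega>) z > e} \<subseteq> ?E"
    proof safe
      fix \<omega> assume "e < dist (Z N \<omega>) z"
      with elim dist_triangle[of "Z N \<omega>" z "m N"] have "e / 2 \<le> norm (Z N \<omega> - m N)"
        by (simp add: dist_norm)
      then show "(e / 2)\<^sup>2 \<le> (norm (Z N \<omega> - m N))\<^sup>2" using e by (intro power_mono) auto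
    qed
    then have "measure M {\<omega> \<in> space M. dist (Z N \<omega>) z > e} \<le> measure M ?E"
      by (rule finite_measure_mono) simp
    also have "\<dots> \<le> expectation (\<lambda>\<omega>. (norm (Z N \<omega> - m N))\<^sup>2) / (e / 2)\<^sup>2"
      by (rule integral_Markov_inequality_measure[where A = "space M"]) (use int e in auto)
    finally show ?case .
  qed
  show "(\<lambda>N. measure M {\<omega> \<in> space M. dist (Z N \<omega>) z > e}) \<longlonglongrightarrow> 0"
    by (rule tendsto_sandwich[OF _ ev tendsto_const lim0]) simp
qed

lemma borel_measurable_matrixI:
  fixes Z :: "'a \<Rightarrow> real ^ 'm::finite ^ 'n::finite"
  assumes "\<And>i j. (\<lambda>\<omega>. Z \<omega> $ i $ j) \<in> borel_measurable M"
  shows "Z \<in> borel_measurable M"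
proof (subst borel_measurable_euclidean_space, intro ballI)
  fix B :: "real ^ 'm ^ 'n" assume "B \<in> Basis"
  then obtain i j where "B = axis i (axis j 1)" by (auto simp: Basis_vec_def)
  then show "(\<lambda>\<omega>. Z \<omega> \<bullet> B) \<in> borel_measurable M"
    using assms by (simp add: inner_axis)
qed

lemma kernel_estimator_measurable:
  fixes Z :: "'a \<Rightarrow> int \<Rightarrow> real ^ 'd::finite"
  assumes Z: "\<And>n i. (\<lambda>\<omega>. Z \<omega> n $ i) \<in> borel_measurable M"
  shows "(\<lambda>\<omega>. kernel_estimator w q N (Z \<omega>)) \<in> borel_measurable M"
proof (rule borel_measurable_matrixI)
  fix i j
  have "(\<lambda>\<omega>. sample_autocov N (Z \<omega>) r $ i $ j) \<in> borel_measurable M" for r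
    using Z by (cases "0 \<le> r") (simp_all add: sample_autocov_def outer_def)
  then show "(\<lambda>\<omega>. kernel_estimator w q N (Z \<omega>) $ i $ j) \<in> borel_measurable M"
    by (simp add: kernel_estimator_def)
qed

section \<open>Consistency of the kernel estimator\<close>

lemma sum_symmetric_int_interval:
  fixes h :: "int \<Rightarrow> 'b::comm_monoid_add"
  shows "(\<Sum>r\<in>{- int q..int q}. h r) = (\<Sum>k=0..q. h (int k)) + (\<Sum>k=1..q. h (- int k))"
proof -
  have "{- int q..int q} = int ` {0..q} \<union> (\<lambda>k. - int k) ` {1..q}"
  proof safe
    fix r assume r: "r \<in> {- int q..int q}" "r \<notin> (\<lambda>k. - int k) ` {1..q}"
    show "r \<in> int ` {0..q}"
    proof (cases "r \<ge> 0")
      case True then show ?thesis using r(1) by (intro image_eqI[of _ _ "nat r"]) auto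
    next
      case False
      then have "r \<in> (\<lambda>k. - int k) ` {1..q}" using r(1) by (intro image_eqI[of _ _ "nat (- r)"]) auto
      then show ?thesis using r(2) by simp
    qed
  qed auto
  then have "(\<Sum>r\<in>{- int q..int q}. h r) = (\<Sum>r\<in>int ` {0..q}. h r) + (\<Sum>r\<in>(\<lambda>k. - int k) ` {1..q}. h r)"
    by (simp only:) (rule sum.union_disjoint, auto)
  then show ?thesis by (simp add: sum.reindex inj_on_def)
qed

context L4_shift_scores begin

definition Y :: "'w \<Rightarrow> int \<Rightarrow> real ^ 'd" where "Y \<omega> n = (\<chi> i. x i n \<omega>)"

definition \<Gamma> :: "int \<Rightarrow> real ^ 'd ^ 'd" where
  "\<Gamma> r = (\<chi> i j. expectation (\<lambda>\<omega>. x i 0 \<omega> * x j r \<omega>))"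

text \<open>The effective weight of \<open>\<Gamma> r\<close> in the mean of the kernel estimator: the sample autocovariance at lag \<open>r\<close> has \<open>N - \<bar>r\<bar>\<close>
summands (none if \<open>N \<le> \<bar>r\<bar>\<close>) but is divided by \<open>N\<close>.\<close>

definition taper :: "(nat \<Rightarrow> int \<Rightarrow> real) \<Rightarrow> nat \<Rightarrow> nat \<Rightarrow> int \<Rightarrow> real" where
  "taper w q N r = w q r * (real (card {1..int N - \<bar>r\<bar>}) / real N)"

text \<open>In the entry \<open>(i, j)\<close> the lag \<open>-k\<close> contributes the products that belong to lag \<open>k\<close> in the entry \<open>(j, i)\<close>. Lag 0 is
counted in the first sum, so its weight in the second sum is 0.\<close>

lemma centred_estimator_entry:
  fixes w :: "nat \<Rightarrow> int \<Rightarrow> real"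
  defines "I \<equiv> \<lambda>N k. {1..int N - int k}"
  shows "(kernel_estimator w q N (Y \<omega>) - (\<Sum>r\<in>{- int q..int q}. taper w q N r *\<^sub>R \<Gamma> r)) $ i $ j =
    weighted_sum i j (\<lambda>k. w q (int k)) q (I N) \<omega> / real N +
    weighted_sum j i (\<lambda>k. if k = 0 then 0 else w q (- int k)) q (I N) \<omega> / real N"
proof -
  define h where "h = (\<lambda>r. (w q r *\<^sub>R sample_autocov N (Y \<omega>) r - taper w q N r *\<^sub>R \<Gamma> r) $ i $ j)"
  have pos: "h (int k) = w q (int k) * (\<Sum>n\<in>I N k. centred i j k n \<omega>) / real N" for k
    by (simp add: h_def sample_autocov_def outer_def Y_def \<Gamma>_def taper_def centred_def I_def
        sum_subtractf diff_divide_distrib right_diff_distrib)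
  have neg: "h (- int k) = w q (- int k) * (\<Sum>n\<in>I N k. centred j i k n \<omega>) / real N" if "1 \<le> k" for k
  proof -
    have "expectation (\<lambda>\<omega>. x i 0 \<omega> * x j (- int k) \<omega>) = expectation (\<lambda>\<omega>. x j 0 \<omega> * x i (int k) \<omega>)"
      using x_product_shift[of i 0 "int k" j "- int k"] by (simp add: mult.commute)
    moreover have swap: "x i (n + int k) \<omega> * x j n \<omega> = x j n \<omega> * x i (n + int k) \<omega>" for n
      by (rule mult.commute)
    ultimately show ?thesis
      using that
      by (simp add: h_def sample_autocov_def outer_def Y_def \<Gamma>_def taper_def centred_def I_def
        sum_subtractf diff_divide_distrib right_diff_distrib mult.assoc swap)
  qed
  have "(kernel_estimator w q N (Y \<omega>) - (\<Sum>r\<in>{- int q..int q}. taper w q N r *\<^sub>R \<Gamma> r)) $ i $ j =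
      (\<Sum>r\<in>{- int q..int q}. h r)"
    by (simp add: kernel_estimator_def h_def sum_subtractf)
  also have "\<dots> = (\<Sum>k=0..q. h (int k)) + (\<Sum>k=1..q. h (- int k))"
    by (rule sum_symmetric_int_interval)
  also have "(\<Sum>k=0..q. h (int k)) = weighted_sum i j (\<lambda>k. w q (int k)) q (I N) \<omega> / real N"
    by (simp add: pos weighted_sum_def sum_divide_distrib)
  also have "(\<Sum>k=1..q. h (- int k)) = (\<Sum>k=0..q. if k = 0 then 0 else h (- int k))"
    by (rule sum.mono_neutral_cong_left) auto
  also have "\<dots> = weighted_sum j i (\<lambda>k. if k = 0 then 0 else w q (- int k)) q (I N) \<omega> / real N"
    unfolding weighted_sum_def sum_divide_distrib by (intro sum.cong refl) (simp add: neg)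
  finally show ?thesis .
qed

lemma weighted_sum_measurable [measurable]: "weighted_sum i j u q I \<in> borel_measurable M"
  unfolding weighted_sum_def centred_def by simp

text \<open>The mean of the estimator converges to the series, as the taper is bounded and tends to 1 at each lag. The variance of each entry is
controlled by the two weighted sums into which it splits.\<close>

lemma kernel_estimator_consistent:
  assumes bw: "bandwidth_weights q w"
    and \<Gamma>: "(\<lambda>r. norm (\<Gamma> r)) summable_on UNIV"
    and R: "\<And>i j. (\<lambda>N. (1 / real N) * (\<Sum>k=0..q N. \<Sum>l=0..q N. \<Sum>r=1..N - 1. coupling_cov i j k l r)) \<longlonglongrightarrow> 0"
  shows "tendsto_in_probability M (\<lambda>N \<omega>. kernel_estimator w (q N) N (Y \<omega>)) (\<Sum>\<^sub>\<infinity>r. \<Gamma> r)"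
proof -
  obtain b where b: "\<And>k j. \<bar>w k j\<bar> \<le> b" using bw by (auto simp: bandwidth_weights_def)
  have b0: "0 \<le> b" using b[of 0 0] by linarith
  have q: "filterlim q at_top sequentially" "(\<lambda>N. (real (q N))\<^sup>2 / real N) \<longlonglongrightarrow> 0"
    and w: "\<And>j. (\<lambda>k. w k j) \<longlonglongrightarrow> 1"
    using bw by (auto simp: bandwidth_weights_def)
  have mean: "(\<lambda>N. \<Sum>r\<in>{- int (q N)..int (q N)}. taper w (q N) N r *\<^sub>R \<Gamma> r) \<longlonglongrightarrow> (\<Sum>\<^sub>\<infinity>r. \<Gamma> r)"
  proof (rule truncated_weighted_sum_tendsto_infsum[OF \<Gamma> q(1)])
    fix r :: int
    \<comment> \<open>As soon as \<open>N > \<bar>r\<bar>\<close>, the tapering factor is \<open>1 - \<bar>r\<bar> / N\<close>.\<close>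
    have "(\<lambda>N. 1 - real_of_int \<bar>r\<bar> * (1 / real N)) \<longlonglongrightarrow> 1 - real_of_int \<bar>r\<bar> * 0"
      by (intro tendsto_intros lim_1_over_n)
    moreover have "\<forall>\<^sub>F N in sequentially. 1 - \<bar>r\<bar> * (1 / real N) = real (card {1..int N - \<bar>r\<bar>}) / real N"
      using eventually_ge_at_top[of "nat \<bar>r\<bar> + 1"]
      by eventually_elim (simp add: field_simps)
    ultimately have "(\<lambda>N. real (card {1..int N - \<bar>r\<bar>}) / real N) \<longlonglongrightarrow> 1"
      by (simp add: Lim_transform_eventually)
    from tendsto_mult[OF filterlim_compose[OF w q(1)] this]
    show "(\<lambda>N. taper w (q N) N r) \<longlonglongrightarrow> 1" by (simp add: taper_def)
    fix N
    have "real (card {1..int N - \<bar>r\<bar>}) / real N \<le> 1"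
      by (cases "N = 0") (auto simp: divide_le_eq)
    then have "\<bar>w (q N) r\<bar> * (real (card {1..int N - \<bar>r\<bar>}) / real N) \<le> b * 1"
      using b b0 by (intro mult_mono) auto
    then show "\<bar>taper w (q N) N r\<bar> \<le> b"
      by (simp add: taper_def abs_mult del: card_atLeastAtMost_int)
  qed
  let ?I = "\<lambda>N k. {1..int N - int k}"
  let ?V1 = "\<lambda>i j N \<omega>. weighted_sum i j (\<lambda>k. w (q N) (int k)) (q N) (?I N) \<omega> / real N"
  let ?V2 = "\<lambda>i j N \<omega>. weighted_sum j i (\<lambda>k. if k = 0 then 0 else w (q N) (- int k)) (q N) (?I N) \<omega> / real N"
  have int: "integrable M (\<lambda>\<omega>. (?V1 i j N \<omega>)\<^sup>2)" "integrable M (\<lambda>\<omega>. (?V2 i j N \<omega>)\<^sup>2)" for i j N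
    unfolding power_divide
    by (intro integrable_divide_zero weighted_sum_second_moment(1)[where b=b and N=N] impI; use b b0 in auto)+
  have lim: "(\<lambda>N. expectation (\<lambda>\<omega>. (?V1 i j N \<omega>)\<^sup>2)) \<longlonglongrightarrow> 0" "(\<lambda>N. expectation (\<lambda>\<omega>. (?V2 i j N \<omega>)\<^sup>2)) \<longlonglongrightarrow> 0" for i j
    by (rule weighted_sum_second_moment_tendsto[OF q(2) R, where b = b]; use b b0 in auto)+
  have sq: "(s + t)\<^sup>2 \<le> 2 * s\<^sup>2 + 2 * t\<^sup>2" for s t :: real
    using sum_squares_bound[of s t] by (simp add: power2_sum)
  show ?thesis
  proof (rule tendsto_in_probability_L2[OF mean])
    fix i j
    show int_sum: "integrable M (\<lambda>\<omega>. ((kernel_estimator w (q N) N (Y \<omega>) -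
        (\<Sum>r\<in>{- int (q N)..int (q N)}. taper w (q N) N r *\<^sub>R \<Gamma> r)) $ i $ j)\<^sup>2)" for N
      unfolding centred_estimator_entry
      by (rule Bochner_Integration.integrable_bound[of _ "\<lambda>\<omega>. 2 * (?V1 i j N \<omega>)\<^sup>2 + 2 * (?V2 i j N \<omega>)\<^sup>2"])
        (use int sq in \<open>auto intro!: AE_I2 simp del: power_divide\<close>)
    have "(\<lambda>N. 2 * expectation (\<lambda>\<omega>. (?V1 i j N \<omega>)\<^sup>2) + 2 * expectation (\<lambda>\<omega>. (?V2 i j N \<omega>)\<^sup>2)) \<longlonglongrightarrow> 2 * 0 + 2 * 0"
      by (intro tendsto_intros lim)
    then have z: "(\<lambda>N. 2 * expectation (\<lambda>\<omega>. (?V1 i j N \<omega>)\<^sup>2) + 2 * expectation (\<lambda>\<omega>. (?V2 i j N \<omega>)\<^sup>2)) \<longlonglongrightarrow> 0"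
      by simp
    have le: "expectation (\<lambda>\<omega>. ((kernel_estimator w (q N) N (Y \<omega>) -
        (\<Sum>r\<in>{- int (q N)..int (q N)}. taper w (q N) N r *\<^sub>R \<Gamma> r)) $ i $ j)\<^sup>2) \<le>
        2 * expectation (\<lambda>\<omega>. (?V1 i j N \<omega>)\<^sup>2) + 2 * expectation (\<lambda>\<omega>. (?V2 i j N \<omega>)\<^sup>2)" for N
    proof -
      have "expectation (\<lambda>\<omega>. ((kernel_estimator w (q N) N (Y \<omega>) -
        (\<Sum>r\<in>{- int (q N)..int (q N)}. taper w (q N) N r *\<^sub>R \<Gamma> r)) $ i $ j)\<^sup>2) \<le>
        expectation (\<lambda>\<omega>. 2 * (?V1 i j N \<omega>)\<^sup>2 + 2 * (?V2 i j N \<omega>)\<^sup>2)"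
        by (intro integral_mono int_sum Bochner_Integration.integrable_add integrable_mult_right int)
          (simp only: centred_estimator_entry sq)
      then show ?thesis by (simp add: int del: power_divide)
    qed
    show "(\<lambda>N. expectation (\<lambda>\<omega>. ((kernel_estimator w (q N) N (Y \<omega>) -
        (\<Sum>r\<in>{- int (q N)..int (q N)}. taper w (q N) N r *\<^sub>R \<Gamma> r)) $ i $ j)\<^sup>2)) \<longlonglongrightarrow> 0"
      by (rule tendsto_sandwich[OF _ _ tendsto_const z]) (use le in \<open>auto intro!: always_eventually\<close>)
  qed
qed

end

section \<open>Scores of Hilbert space valued processes\<close>

locale hilbert_shift = coupled_innovations M S \<epsilon> \<epsilon>c
  for M :: "'w measure" and S :: "'s measure" and \<epsilon> :: "int \<Rightarrow> 'w \<Rightarrow> 's" and \<epsilon>c :: "int \<Rightarrow> int \<Rightarrow> 'w \<Rightarrow> 's" +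
  fixes f :: "(nat \<Rightarrow> 's) \<Rightarrow> real \<Rightarrow> real" and X :: "int \<Rightarrow> 'w \<Rightarrow> real \<Rightarrow> real"
    and v :: "'d::finite \<Rightarrow> real \<Rightarrow> real"
  assumes f_measurable: "f \<in> PiM UNIV (\<lambda>_. S) \<rightarrow>\<^sub>M H_borel"
    and X_measurable: "X n \<in> M \<rightarrow>\<^sub>M H_borel"
    and X_shift: "AE \<omega> in M. AE t in unit_lborel. X n \<omega> t = f (\<lambda>a. \<epsilon> (n - int a) \<omega>) t"
    and v_orthonormal: "orthonormal_H v"
    and mean_zero: "expectation (\<lambda>\<omega>. H_inner (X 0 \<omega>) (v i)) = 0"
begin

lemma v_carrier: "v i \<in> H_carrier"
  using v_orthonormal by (simp add: orthonormal_H_def)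

lemma v_norm: "H_norm (v i) = 1"
  using v_orthonormal by (simp add: orthonormal_H_def H_norm_def H_inner_def power2_eq_square)

lemma X_carrier: "\<omega> \<in> space M \<Longrightarrow> X n \<omega> \<in> H_carrier"
  using measurable_space[OF X_measurable] by (simp add: space_H_borel)

lemma f_carrier: "A \<in> M \<rightarrow>\<^sub>M Seq \<Longrightarrow> \<omega> \<in> space M \<Longrightarrow> f (A \<omega>) \<in> H_carrier"
  using measurable_space[OF measurable_compose[OF _ f_measurable]] by (simp add: space_H_borel)

lemma f_inner_measurable: "(\<lambda>s. H_inner (f s) (v i)) \<in> borel_measurable Seq"
  by (rule measurable_compose[OF f_measurable H_inner_measurable[OF v_carrier]])

lemma H_inner_norm_cong_AE:
  assumes g: "g \<in> H_carrier" "h \<in> H_carrier" and eq: "AE t in unit_lborel. g t = h t"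
  shows "H_inner g (v i) = H_inner h (v i)" "H_norm g = H_norm h"
  using g v_carrier[of i] eq unfolding H_inner_def H_norm_def
  by (auto simp: H_carrier_def intro!: integral_cong_AE)

lemma X_window_AE:
  "AE \<omega> in M. (\<forall>i. H_inner (X n \<omega>) (v i) = H_inner (f (\<lambda>a. \<epsilon> (n - int a) \<omega>)) (v i)) \<and>
     H_norm (X n \<omega>) = H_norm (f (\<lambda>a. \<epsilon> (n - int a) \<omega>))"
  using X_shift[of n] AE_space
proof eventually_elim
  case (elim \<omega>)
  show ?case
    using H_inner_norm_cong_AE[OF X_carrier[OF elim(2)] f_carrier[OF eps_path_measurable elim(2)] elim(1)]
    by simp
qed

lemma X_norm_AE: "AE \<omega> in M. H_norm (X n \<omega>) = H_norm (f (\<lambda>a. \<epsilon> (n - int a) \<omega>))"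
  using X_window_AE[of n] by (rule eventually_mono) simp

text \<open>The scores of \<open>X\<close> are, up to null sets, the real functionals \<open>s \<mapsto> \<langle>f s, v\<^sub>i\<rangle>\<close> of the innovations, so the results on real
scores apply.\<close>

sublocale shift_scores M S \<epsilon> \<epsilon>c "\<lambda>i s. H_inner (f s) (v i)"
proof
  fix i
  show "(\<lambda>s. H_inner (f s) (v i)) \<in> borel_measurable Seq" by (rule f_inner_measurable)
  have "expectation (\<lambda>\<omega>. H_inner (f (past \<omega>)) (v i)) = expectation (\<lambda>\<omega>. H_inner (X 0 \<omega>) (v i))"
  proof (rule integral_cong_AE)
    show "AE \<omega> in M. H_inner (f (past \<omega>)) (v i) = H_inner (X 0 \<omega>) (v i)"
      using X_window_AE[of 0] by eventually_elim (simp add: past_def)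
    show "(\<lambda>\<omega>. H_inner (f (past \<omega>)) (v i)) \<in> borel_measurable M"
      by (rule measurable_compose[OF past_measurable f_inner_measurable])
    show "(\<lambda>\<omega>. H_inner (X 0 \<omega>) (v i)) \<in> borel_measurable M"
      by (rule measurable_compose[OF X_measurable H_inner_measurable[OF v_carrier]])
  qed
  then show "expectation (\<lambda>\<omega>. H_inner (f (past \<omega>)) (v i)) = 0"
    using mean_zero by simp
qed

text \<open>One null set serves all times and coordinates, as there are countably many.\<close>

lemma scores_AE: "AE \<omega> in M. \<forall>n i. scores v (X n \<omega>) $ i = x i n \<omega>"
  unfolding AE_all_countable
proof (intro allI)
  fix n i
  show "AE \<omega> in M. scores v (X n \<omega>) $ i = x i n \<omega>"
    using X_window_AE[of n] by (rule eventually_mono) (simp add: scores_def x_def)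
qed

lemma score_AE: "AE \<omega> in M. scores v (X n \<omega>) $ i = x i n \<omega>"
  using scores_AE by (rule eventually_mono) simp

lemma scores_X_measurable: "(\<lambda>\<omega>. scores v (X n \<omega>) $ i) \<in> borel_measurable M"
  using measurable_compose[OF X_measurable H_inner_measurable[OF v_carrier]] by (simp add: scores_def)

lemma scores_coupled: "scores v (coupled f \<epsilon> \<epsilon>c (int k) k \<omega>) $ i = x' i k \<omega>"
  by (simp add: scores_def x'_def coupled_eq_splice)

lemma splice_copy_measurable: "(\<lambda>\<omega>. splice k (future \<omega>) (past_copy k (copies \<omega>))) \<in> M \<rightarrow>\<^sub>M Seq"
  using measurable_compose[OF measurable_Pair[OF future_measurable measurable_compose[OF copies_measurable past_copy_measurable]]
      splice_measurable] by simp

lemma f_norm_measurable: "(\<lambda>s. H_norm (f s)) \<in> borel_measurable Seq"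
  by (rule measurable_compose[OF f_measurable H_norm_measurable])

context
  fixes p :: nat
  assumes p: "0 < p" and X_Lp: "X 0 \<in> LpH M (real p)"
begin

lemma norm_window_Lp: "Lp_le M p (\<lambda>\<omega>. H_norm (f (\<lambda>a. \<epsilon> (n - int a) \<omega>))) (nu M p (X 0))"
proof -
  have "Lp_le M p (\<lambda>\<omega>. H_norm (X 0 \<omega>)) (nu M p (X 0))"
    using X_Lp p measurable_compose[OF X_measurable H_norm_measurable]
    by (intro Lp_le_nu) (auto simp: LpH_def H_norm_nonneg)
  from Lp_le_cong_AE[OF X_norm_AE[of 0] measurable_compose[OF eps_path_measurable f_norm_measurable] this]
  have "Lp_le M p (\<lambda>\<omega>. H_norm (f (past \<omega>))) (nu M p (X 0))"
    by (simp add: past_def)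
  then show ?thesis
    by (rule Lp_le_law[OF past_measurable eps_path_measurable f_norm_measurable law_window[symmetric]])
qed

lemma norm_coupled_Lp:
  "Lp_le M p (\<lambda>\<omega>. H_norm (f (splice k (future \<omega>) (past_copy k (copies \<omega>))))) (nu M p (X 0))"
proof -
  have law: "distr M Seq (\<lambda>\<omega> a. \<epsilon> (int k - int a) \<omega>) =
      distr M Seq (\<lambda>\<omega>. splice k (future \<omega>) (past_copy k (copies \<omega>)))"
    unfolding window_eq_splice law_coupled ..
  show ?thesis
    using norm_window_Lp[of "int k"]
    by (rule Lp_le_law[OF eps_path_measurable[of "\<lambda>a. int k - int a"] splice_copy_measurable f_norm_measurable law])
qed

lemma x_Lp: "Lp_le M p (x i n) (nu M p (X 0))"
proof (rule Lp_le_dominated[OF norm_window_Lp x_measurable])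
  fix \<omega> assume "\<omega> \<in> space M"
  from H_inner_bound(2)[OF f_carrier[OF eps_path_measurable this] v_carrier[of i], of "\<lambda>a. n - int a"]
  show "\<bar>x i n \<omega>\<bar> \<le> \<bar>H_norm (f (\<lambda>a. \<epsilon> (n - int a) \<omega>))\<bar>"
    by (simp add: x_def v_norm H_norm_nonneg)
qed

lemma x'_Lp: "Lp_le M p (x' i k) (nu M p (X 0))"
proof (rule Lp_le_dominated[OF norm_coupled_Lp[of k] x'_measurable])
  fix \<omega> assume "\<omega> \<in> space M"
  from H_inner_bound(2)[OF f_carrier[OF splice_copy_measurable this] v_carrier[of i], of k]
  show "\<bar>x' i k \<omega>\<bar> \<le> \<bar>H_norm (f (splice k (future \<omega>) (past_copy k (copies \<omega>))))\<bar>"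
    by (simp add: x'_def v_norm H_norm_nonneg)
qed

text \<open>A difference of scores is the score of the difference, at most its norm because \<open>v i\<close> is a unit vector. The triangle inequality
first shows that the moment of the norm is finite, as \<open>nu\<close> would otherwise take the value 0.\<close>

lemma coupling_error_Lp:
  "Lp_le M p (\<lambda>\<omega>. x i (int k) \<omega> - x' i k \<omega>) (nu M p (\<lambda>\<omega> t. X (int k) \<omega> t - coupled f \<epsilon> \<epsilon>c (int k) k \<omega> t))"
proof -
  let ?c = "\<lambda>\<omega>. f (splice k (future \<omega>) (past_copy k (copies \<omega>)))"
  have [measurable]: "(\<lambda>\<omega>. H_norm (X (int k) \<omega>)) \<in> borel_measurable M"
    by (rule measurable_compose[OF X_measurable H_norm_measurable])
  have "Lp_le M p (\<lambda>\<omega>. H_norm (X (int k) \<omega>)) (nu M p (X 0))"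
    by (rule Lp_le_cong_AE[OF _ _ norm_window_Lp]) (use X_norm_AE[of "int k"] in \<open>simp_all add: eq_commute\<close>)
  \<comment> \<open>The sum of the two norms is written as a difference, the form in which the moment bound for two functions is available.\<close>
  moreover have "Lp_le M p (\<lambda>\<omega>. - H_norm (?c \<omega>)) (nu M p (X 0))"
    using Lp_le_measurable[OF norm_coupled_Lp[of k]] by (intro Lp_le_dominated[OF norm_coupled_Lp[of k]]) auto
  ultimately have sum: "Lp_le M p (\<lambda>\<omega>. H_norm (X (int k) \<omega>) - - H_norm (?c \<omega>)) (4 * nu M p (X 0))"
    by (rule Lp_le_diff[OF p])
  have diff: "H_norm (\<lambda>t. X (int k) \<omega> t - ?c \<omega> t) \<le> H_norm (X (int k) \<omega>) + H_norm (?c \<omega>)" if "\<omega> \<in> space M" for \<omega>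
    by (rule H_norm_triangle[OF X_carrier[OF that] f_carrier[OF splice_copy_measurable that]])
  have "(\<integral>\<^sup>+ \<omega>. ennreal (H_norm (\<lambda>t. X (int k) \<omega> t - ?c \<omega> t) powr real p) \<partial>M) \<le>
      (\<integral>\<^sup>+ \<omega>. ennreal (\<bar>H_norm (X (int k) \<omega>) - - H_norm (?c \<omega>)\<bar> ^ p) \<partial>M)"
    using diff p by (intro nn_integral_mono ennreal_leI)
      (simp add: powr_realpow' H_norm_nonneg power_mono)
  also have "\<dots> < \<infinity>" using sum by (auto simp: Lp_le_def intro: le_less_trans)
  finally have fin: "(\<integral>\<^sup>+ \<omega>. ennreal (H_norm (\<lambda>t. X (int k) \<omega> t - coupled f \<epsilon> \<epsilon>c (int k) k \<omega> t) powr real p) \<partial>M) < \<infinity>"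
    by (simp add: coupled_eq_splice)
  have "Lp_le M p (\<lambda>\<omega>. scores v (X (int k) \<omega>) $ i - x' i k \<omega>)
      (nu M p (\<lambda>\<omega> t. X (int k) \<omega> t - coupled f \<epsilon> \<epsilon>c (int k) k \<omega> t))"
  proof (rule Lp_le_nu[OF _ _ fin p])
    show "(\<lambda>\<omega>. scores v (X (int k) \<omega>) $ i - x' i k \<omega>) \<in> borel_measurable M"
      using scores_X_measurable by simp
    fix \<omega> assume \<omega>: "\<omega> \<in> space M"
    note c = X_carrier[OF \<omega>, of "int k"] f_carrier[OF splice_copy_measurable \<omega>, of k]
    show "\<bar>scores v (X (int k) \<omega>) $ i - x' i k \<omega>\<bar> \<le> H_norm (\<lambda>t. X (int k) \<omega> t - coupled f \<epsilon> \<epsilon>c (int k) k \<omega> t)"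
      using H_inner_bound(2)[OF H_carrier_diff[OF c] v_carrier[of i]] H_inner_diff[OF c v_carrier[of i]]
      by (simp add: scores_def x'_def coupled_eq_splice v_norm)
  qed
  then show ?thesis
    by (rule Lp_le_cong_AE[rotated 2]) (rule eventually_mono[OF score_AE[of "int k" i]], simp_all)
qed

end

lemma autocov_entry: "autocov M v X r $ i $ j = expectation (\<lambda>\<omega>. x i 0 \<omega> * x j r \<omega>)"
proof -
  have "AE \<omega> in M. scores v (X 0 \<omega>) $ i * scores v (X r \<omega>) $ j = x i 0 \<omega> * x j r \<omega>"
    using scores_AE by (rule eventually_mono) simp
  then show ?thesis
    unfolding autocov_def using scores_X_measurable by (simp add: integral_cong_AE)
qed

lemma autocov_absolutely_summable:
  assumes X: "X 0 \<in> LpH M 2"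
    and s: "summable (\<lambda>m. nu M 2 (\<lambda>\<omega> t. X (int (Suc m)) \<omega> t - coupled f \<epsilon> \<epsilon>c (int (Suc m)) (Suc m) \<omega> t))"
  shows "(\<lambda>r. norm (autocov M v X r)) summable_on UNIV"
proof -
  define a where "a = (\<lambda>k. nu M 2 (\<lambda>\<omega> t. X (int k) \<omega> t - coupled f \<epsilon> \<epsilon>c (int k) k \<omega> t))"
  define K where "K = nu M 2 (X 0)"
  have decay: "\<bar>expectation (\<lambda>\<omega>. x i 0 \<omega> * x j (int k) \<omega>)\<bar> \<le> K * a k" for i j k
    unfolding K_def a_def
    using X x_Lp[of 2] x'_Lp[of 2] coupling_error_Lp[of 2]
    by (intro autocovariance_decay) simp_all
  have "summable (\<lambda>k. K * a (Suc k))"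
    using s by (intro summable_mult) (simp add: a_def)
  then have "(\<lambda>r. \<bar>autocov M v X r $ i $ j\<bar>) summable_on UNIV" for i j
  proof (rule summable_on_int)
    fix k
    show "\<bar>\<bar>autocov M v X (int (Suc k)) $ i $ j\<bar>\<bar> \<le> K * a (Suc k)"
      using decay[of i j "Suc k"] by (simp only: autocov_entry abs_idempotent)
    have "expectation (\<lambda>\<omega>. x i 0 \<omega> * x j (- int (Suc k)) \<omega>) = expectation (\<lambda>\<omega>. x j 0 \<omega> * x i (int (Suc k)) \<omega>)"
      using x_product_shift[of i 0 "int (Suc k)" j "- int (Suc k)"] by (simp add: mult.commute)
    then show "\<bar>\<bar>autocov M v X (- int (Suc k)) $ i $ j\<bar>\<bar> \<le> K * a (Suc k)"
      using decay[of j i "Suc k"] by (simp only: autocov_entry abs_idempotent)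
  qed
  then have "(\<lambda>r. \<Sum>i\<in>UNIV. \<Sum>j\<in>UNIV. \<bar>autocov M v X r $ i $ j\<bar>) summable_on UNIV"
    by (intro summable_on_finite_sum) simp_all
  then show ?thesis
    by (rule summable_on_comparison_test) (simp_all add: norm_matrix_le)
qed

end

section \<open>Convergence of the long-run covariance series and of its estimator\<close>

theorem corollary4p1:
  fixes M :: "'w measure" and S :: "'s measure"
    and X :: "int \<Rightarrow> 'w \<Rightarrow> real \<Rightarrow> real"
    and f :: "(nat \<Rightarrow> 's) \<Rightarrow> real \<Rightarrow> real"
    and \<epsilon> :: "int \<Rightarrow> 'w \<Rightarrow> 's" and \<epsilon>c :: "int \<Rightarrow> int \<Rightarrow> 'w \<Rightarrow> 's"
    and v :: "'d::finite \<Rightarrow> real \<Rightarrow> real"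
  assumes prob: "prob_space M"
    and X_L2: "\<And>n. X n \<in> LpH M 2"
    and X_joint: "\<And>n. (\<lambda>(t, \<omega>). X n \<omega> t) \<in> borel_measurable (unit_lborel \<Otimes>\<^sub>M M)"
    and X_sup: "(SUP t\<in>{0..1}. \<integral>\<^sup>+ \<omega>. ennreal (\<bar>X 1 \<omega> t\<bar>\<^sup>2) \<partial>M) < \<infinity>"
    and X_zero_mean: "\<And>n. AE t in unit_lborel. (LINT \<omega>|M. X n \<omega> t) = 0"
    and v_orthonormal: "orthonormal_H v"
    and approx_2: "Lp_m_approximable M S f \<epsilon> \<epsilon>c 2 X"
  shows "(\<lambda>r. norm (autocov M v X r)) summable_on (UNIV :: int set) \<and>
    (\<forall>q w.
      Lp_m_approximable M S f \<epsilon> \<epsilon>c 4 X \<longrightarrow>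
      bandwidth_weights q w \<longrightarrow>
      (\<lambda>N. (1 / real N) *
         (\<Sum>k=0..q N. \<Sum>l=0..q N. \<Sum>r=1..N - 1.
           MAX (i, j)\<in>UNIV. \<bar>covariance M
             (\<lambda>\<omega>. scores v (X 0 \<omega>) $ i *
                 (scores v (X (int k) \<omega>) $ j - scores v (coupled f \<epsilon> \<epsilon>c (int k) k \<omega>) $ j))
             (\<lambda>\<omega>. scores v (coupled f \<epsilon> \<epsilon>c (int r) r \<omega>) $ i *
                 scores v (coupled f \<epsilon> \<epsilon>c (int (r + l)) (r + l) \<omega>) $ j)\<bar>))
        \<longlonglongrightarrow> 0 \<longrightarrow>
      tendsto_in_probability M
        (\<lambda>N \<omega>. kernel_estimator w (q N) N (\<lambda>n. scores v (X n \<omega>)))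
        (\<Sum>\<^sub>\<infinity>r. autocov M v X r))"
proof -
  interpret prob_space M by (rule prob)
  have data: "iid_seq M S \<epsilon>" "independent_copies M S \<epsilon> \<epsilon>c" "f \<in> PiM UNIV (\<lambda>_. S) \<rightarrow>\<^sub>M H_borel"
      "\<And>n. AE \<omega> in M. AE t in unit_lborel. X n \<omega> t = f (\<lambda>a. \<epsilon> (n - int a) \<omega>) t"
    and summable_2: "summable (\<lambda>m. nu M 2 (\<lambda>\<omega> t. X (int (Suc m)) \<omega> t - coupled f \<epsilon> \<epsilon>c (int (Suc m)) (Suc m) \<omega> t))"
    using approx_2 by (auto simp: Lp_m_approximable_def)
  interpret hilbert_shift M S \<epsilon> \<epsilon>c f X v
  proof
    fix i
    have "v i \<in> H_carrier" using v_orthonormal by (simp add: orthonormal_H_def)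
    then show "expectation (\<lambda>\<omega>. H_inner (X 0 \<omega>) (v i)) = 0"
      by (rule expectation_H_inner_zero[OF prob X_L2 _ X_joint X_zero_mean])
  qed (use data X_L2 v_orthonormal in \<open>auto simp: LpH_def\<close>)
  have absolutely: "(\<lambda>r. norm (autocov M v X r)) summable_on UNIV"
    by (rule autocov_absolutely_summable[OF X_L2 summable_2])
  moreover have "tendsto_in_probability M
      (\<lambda>N \<omega>. kernel_estimator w (q N) N (\<lambda>n. scores v (X n \<omega>))) (\<Sum>\<^sub>\<infinity>r. autocov M v X r)"
    if approx_4: "Lp_m_approximable M S f \<epsilon> \<epsilon>c 4 X" and bw: "bandwidth_weights q w"
      and cov: "(\<lambda>N. (1 / real N) *
         (\<Sum>k=0..q N. \<Sum>l=0..q N. \<Sum>r=1..N - 1.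
           MAX (i, j)\<in>UNIV. \<bar>covariance M
             (\<lambda>\<omega>. scores v (X 0 \<omega>) $ i *
                 (scores v (X (int k) \<omega>) $ j - scores v (coupled f \<epsilon> \<epsilon>c (int k) k \<omega>) $ j))
             (\<lambda>\<omega>. scores v (coupled f \<epsilon> \<epsilon>c (int r) r \<omega>) $ i *
                 scores v (coupled f \<epsilon> \<epsilon>c (int (r + l)) (r + l) \<omega>) $ j)\<bar>))
        \<longlonglongrightarrow> 0" for q w
  proof -
    define a where "a = (\<lambda>k. nu M 4 (\<lambda>\<omega> t. X (int k) \<omega> t - coupled f \<epsilon> \<epsilon>c (int k) k \<omega> t))"
    define K where "K = nu M 4 (X 0)"
    have X4: "X 0 \<in> LpH M 4" and "summable (\<lambda>k. a (Suc k))"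
      using approx_4 by (auto simp: Lp_m_approximable_def a_def)
    then interpret L4: L4_shift_scores M S \<epsilon> \<epsilon>c "\<lambda>i s. H_inner (f s) (v i)" K a
      using x_Lp[of 4] x'_Lp[of 4] coupling_error_Lp[of 4]
      by unfold_locales (simp_all add: K_def a_def)
    have \<Gamma>: "L4.\<Gamma> = autocov M v X"
      by (simp add: fun_eq_iff vec_eq_iff autocov_entry L4.\<Gamma>_def)
    have R: "(\<lambda>N. (1 / real N) * (\<Sum>k=0..q N. \<Sum>l=0..q N. \<Sum>r=1..N - 1. L4.coupling_cov i j k l r)) \<longlonglongrightarrow> 0" for i j
    proof (rule tendsto_sandwich[OF _ _ tendsto_const cov])
      let ?c = "\<lambda>k l r (i, j). \<bar>covariance M
             (\<lambda>\<omega>. scores v (X 0 \<omega>) $ i *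
                 (scores v (X (int k) \<omega>) $ j - scores v (coupled f \<epsilon> \<epsilon>c (int k) k \<omega>) $ j))
             (\<lambda>\<omega>. scores v (coupled f \<epsilon> \<epsilon>c (int r) r \<omega>) $ i *
                 scores v (coupled f \<epsilon> \<epsilon>c (int (r + l)) (r + l) \<omega>) $ j)\<bar>"
      have "L4.coupling_cov i j k l r \<le> Max (?c k l r ` UNIV)" for k l r
      proof -
        have "AE \<omega> in M. scores v (X 0 \<omega>) $ i * (scores v (X (int k) \<omega>) $ j - x' j k \<omega>) =
            x i 0 \<omega> * (x j (int k) \<omega> - x' j k \<omega>)"
          using scores_AE by (rule eventually_mono) simp
        then have "L4.coupling_cov i j k l r = ?c k l r (i, j)"
          unfolding L4.coupling_cov_def scores_coupled using scores_X_measurable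
          by (simp, intro arg_cong[where f=abs] covariance_cong_AE) auto
        also have "\<dots> \<le> Max (?c k l r ` UNIV)" by (rule Max_ge) auto
        finally show ?thesis .
      qed
      then show "\<forall>\<^sub>F N in sequentially. (1 / real N) * (\<Sum>k=0..q N. \<Sum>l=0..q N. \<Sum>r=1..N - 1. L4.coupling_cov i j k l r) \<le>
          (1 / real N) * (\<Sum>k=0..q N. \<Sum>l=0..q N. \<Sum>r=1..N - 1. Max (?c k l r ` UNIV))"
        by (intro always_eventually allI mult_left_mono sum_mono) auto
      show "\<forall>\<^sub>F N in sequentially. 0 \<le> (1 / real N) * (\<Sum>k=0..q N. \<Sum>l=0..q N. \<Sum>r=1..N - 1. L4.coupling_cov i j k l r)"
        by (intro always_eventually allI mult_nonneg_nonneg sum_nonneg) (auto simp: L4.coupling_cov_def)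
    qed
    have "tendsto_in_probability M (\<lambda>N \<omega>. kernel_estimator w (q N) N (L4.Y \<omega>)) (\<Sum>\<^sub>\<infinity>r. autocov M v X r)"
      using L4.kernel_estimator_consistent[OF bw _ R] absolutely by (simp add: \<Gamma>)
    \<comment> \<open>The scores of \<open>X\<close> agree with the functionals of the innovations only almost surely, so the two events are compared up to
      null sets.\<close>
    moreover have "measure M {\<omega> \<in> space M. dist (kernel_estimator w (q N) N (\<lambda>n. scores v (X n \<omega>))) z > e} =
        measure M {\<omega> \<in> space M. dist (kernel_estimator w (q N) N (L4.Y \<omega>)) z > e}" for N z e
    proof (rule measure_eq_AE)
      show "AE \<omega> in M. (\<omega> \<in> {\<omega> \<in> space M. dist (kernel_estimator w (q N) N (\<lambda>n. scores v (X n \<omega>))) z > e}) =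
          (\<omega> \<in> {\<omega> \<in> space M. dist (kernel_estimator w (q N) N (L4.Y \<omega>)) z > e})"
        using scores_AE
      proof eventually_elim
        case (elim \<omega>)
        then have "(\<lambda>n. scores v (X n \<omega>)) = L4.Y \<omega>"
          by (simp add: fun_eq_iff vec_eq_iff L4.Y_def)
        then show ?case by simp
      qed
      note meas = kernel_estimator_measurable[where M = M and w = w and q = "q N" and N = N]
      show "{\<omega> \<in> space M. dist (kernel_estimator w (q N) N (\<lambda>n. scores v (X n \<omega>))) z > e} \<in> events"
        using meas[of "\<lambda>\<omega> n. scores v (X n \<omega>)"] scores_X_measurable by simp
      show "{\<omega> \<in> space M. dist (kernel_estimator w (q N) N (L4.Y \<omega>)) z > e} \<in> events"
        using meas[of L4.Y] by (simp add: L4.Y_def)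
    qed
    ultimately show ?thesis by (simp add: tendsto_in_probability_def)
  qed
  ultimately show ?thesis by blast
qed

end
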